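(* Let $k$ be a positive integer, $n$ a non-negative integer, and $p$ a prime with $p \equiv 7 \pmod 8$. Let $r$ be a non-negative integer such that $p$ divides $8r+7$. Then (i) $a_2\left( p^{k+1} n + pr + \frac{7p-1}{8} \right) \equiv (-1)\left(\frac{-2}{p}\right) a_2\left( p^{k-1} n + \frac{8r+7-p}{8p} \right) \pmod 2$; (ii) $a_{13}\left( 104\, p^{k+1} n + 104\, pr + 91p - 7 \right) \equiv (-1)\left(\frac{-2}{p}\right) a_{13}\left( 104\, p^{k-1} n + \frac{104 r + 91}{p} - 7 \right) \pmod 2$.
   Context: $\left(\frac{-2}{p}\right)$ is the Legendre symbol. A partition of $n$ is a non-increasing sequence of positive integers summing to $n$; in its Young diagram the hook number of cell $(i,j)$ is $\beta_i + \beta'_j - i - j + 1$ ($\beta_i$ the length of row $i$, $\beta'_j$ the length of column $j$). A $t$-core partition is one with no hook number divisible by $t$. For an integer $m\ge 0$, $a_t(m)$ is the number of $t$-core partitions of $m$; equivalently $\sum_{n\ge 0} a_t(n) q^n = \prod_{n\ge1} \frac{(1-q^{tn})^t}{1-q^n}$. *)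

theory Defs
  imports "HOL-Number_Theory.Number_Theory"
begin

definition is_partition :: "nat \<Rightarrow> nat list \<Rightarrow> bool" where
  "is_partition n lam \<longleftrightarrow> sorted_wrt (\<ge>) lam \<and> (\<forall>x\<in>set lam. 0 < x) \<and> sum_list lam = n"

text \<open>Length of column j (1-indexed): number of rows of length at least j.\<close>
definition col_len :: "nat list \<Rightarrow> nat \<Rightarrow> nat" where
  "col_len lam j = length (filter (\<lambda>x. j \<le> x) lam)"

definition row_len :: "nat list \<Rightarrow> nat \<Rightarrow> nat" where
  "row_len lam i = lam ! (i - 1)"

definition cells :: "nat list \<Rightarrow> (nat \<times> nat) set" where
  "cells lam = {(i, j). 1 \<le> i \<and> i \<le> length lam \<and> 1 \<le> j \<and> j \<le> row_len lam i}"

text \<open>Hook number beta_i + beta'_j - i - j + 1 (nonnegative on cells).\<close>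
definition hook :: "nat list \<Rightarrow> nat \<Rightarrow> nat \<Rightarrow> int" where
  "hook lam i j = int (row_len lam i) + int (col_len lam j) - int i - int j + 1"

definition is_core :: "nat \<Rightarrow> nat list \<Rightarrow> bool" where
  "is_core t lam \<longleftrightarrow> (\<forall>(i, j)\<in>cells lam. \<not> int t dvd hook lam i j)"

definition a_core :: "nat \<Rightarrow> nat \<Rightarrow> nat" where
  "a_core t m = card {lam. is_partition m lam \<and> is_core t lam}"

end

theory Submission
  imports Defs "HOL-Library.Z2" "HOL-Library.FuncSet" "HOL-Computational_Algebra.Formal_Power_Series"
begin

text \<open>
  The 2-cores are the staircases, so \<open>a\<^sub>2(n)\<close> counts the \<open>y \<ge> 0\<close> with \<open>y\<^sup>2 = 8 n + 1\<close>. In (i) the two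
  arguments \<open>N\<close> and \<open>M\<close> satisfy \<open>8 N + 1 = p\<^sup>2 (8 M + 1)\<close>, so both sides agree up to sign. Part (ii)
  reduces to (i) because \<open>a\<^sub>1\<^sub>3(104 n + 6)\<close> and \<open>a\<^sub>2(n)\<close> have the same parity.

  For this parity statement, conjugation leaves only the self-conjugate 13-cores to be counted. A
  core is encoded by the first gap of its beta set in each residue class modulo 13; after centring, the
  self-conjugate cores of \<open>m\<close> become the \<open>g \<in> \<int>\<^sup>6\<close> with \<open>\<Sum>\<^sub>i (13 g\<^sub>i\<^sup>2 + 2 i g\<^sub>i) = m\<close>. Their
  generating function \<open>G\<close> is a product of six theta series, and with \<open>f\<^sub>d = \<Prod>\<^sub>m (1 - q\<^sup>d\<^sup>m)\<close> the triple
  product gives \<open>G f\<^sub>1 = f\<^sub>1\<^sub>3\<^bsup>13\<^esup>\<close> modulo 2, hence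
  \<open>(f\<^sub>1\<^sup>2)\<^sup>4 G = (f\<^sub>1\<^sub>3\<^sup>3 f\<^sub>1)\<^sup>4 \<cdot> f\<^sub>1\<^sup>3 f\<^sub>1\<^sub>3\<close>. Fourth powers are series in \<open>q\<^sup>4\<close>, so they pass through the
  extraction of the coefficients with index \<open>4 k + 2\<close>, and a bijection between representations by the forms
  \<open>3 x\<^sup>2 + 13 y\<^sup>2\<close> and \<open>39 a\<^sup>2 + b\<^sup>2\<close> shows that this extraction sends \<open>f\<^sub>1\<^sup>3 f\<^sub>1\<^sub>3\<close> to
  \<open>q f\<^sub>1 f\<^sub>1\<^sub>3\<^sup>3\<close>. Therefore \<open>G\<close> is sent to \<open>q f\<^sub>1\<^sub>3\<^sup>6\<close>, in which the coefficient of \<open>q\<^bsup>26 n + 1\<^esup>\<close> is that of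
  \<open>q\<^sup>n\<close> in \<open>f\<^sub>1\<^sup>3\<close>: 1 exactly for triangular \<open>n\<close>.
\<close>

section \<open>Infinite products of distinct factors modulo 2\<close>

unbundle fps_syntax
declare add_bit_eq_xor [simp del] mult_bit_eq_and [simp del]

lemma bit_add_self [simp]: "(x::bit) + x = 0"
  by (cases x) simp_all

lemma fps_bit_add_self [simp]: "(f::bit fps) + f = 0"
  by (intro fps_ext) (simp only: fps_add_nth bit_add_self fps_zero_nth)

lemma fps_bit_square_one_plus: "(1 + f)\<^sup>2 = (1::bit fps) + f\<^sup>2"
  by (simp only: power2_sum mult_2 distrib_right fps_bit_add_self add_0_right mult_1_right power_one)

text \<open>A coefficient of a product involves only finitely many coefficients of the factors, each
  eventually constant.\<close>

lemma tendsto_mult_fps: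
  fixes a b :: "'a::comm_ring_1 fps"
  assumes "(f \<longlongrightarrow> a) F" "(g \<longlongrightarrow> b) F"
  shows "((\<lambda>x. f x * g x) \<longlongrightarrow> a * b) F"
proof (rule tendsto_fpsI)
  fix n
  have "\<forall>\<^sub>F x in F. \<forall>i\<in>{0..n}. f x $ i = a $ i"
    using assms(1) by (intro eventually_ball_finite) (auto simp: tendsto_fps_iff)
  moreover have "\<forall>\<^sub>F x in F. \<forall>i\<in>{0..n}. g x $ i = b $ i"
    using assms(2) by (intro eventually_ball_finite) (auto simp: tendsto_fps_iff)
  ultimately show "\<forall>\<^sub>F x in F. (f x * g x) $ n = (a * b) $ n"
    by eventually_elim (simp add: fps_mult_nth)
qed

text \<open>Modulo 2 the factors \<open>1 + q^m\<close> and \<open>1 - q^m\<close> agree. Cutting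
  off at \<open>n\<close> for the coefficient of \<open>q^n\<close> defines infinite products
  without a limit.\<close>

definition distinct_prod :: "nat set \<Rightarrow> bit fps" where
  "distinct_prod A = Abs_fps (\<lambda>n. (\<Prod>m\<in>A \<inter> {1..n}. 1 + fps_X ^ m) $ n)"

lemma prod_large_nth:
  assumes "finite F" "\<And>m. m \<in> F \<Longrightarrow> n < m" "i \<le> n"
  shows "((\<Prod>m\<in>F. 1 + fps_X ^ m) :: bit fps) $ i = (1 :: bit fps) $ i"
  using assms
proof (induction F rule: finite_induct)
  case (insert x F)
  then have "i < x" by force
  then show ?case using insert
    by (simp add: distrib_right fps_X_power_mult_nth)
qed simp

lemma prod_truncate_nth:
  assumes "finite F"
  shows "((\<Prod>m\<in>F. 1 + fps_X ^ m) :: bit fps) $ n = (\<Prod>m\<in>F \<inter> {..n}. 1 + fps_X ^ m) $ n"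
proof -
  have "(\<Prod>m\<in>F. 1 + fps_X ^ m) =
      ((\<Prod>m\<in>F \<inter> {..n}. 1 + fps_X ^ m) :: bit fps) * (\<Prod>m\<in>F - {..n}. 1 + fps_X ^ m)"
    using assms by (metis prod.Int_Diff)
  also have "\<dots> $ n = ((\<Prod>m\<in>F \<inter> {..n}. 1 + fps_X ^ m) * 1) $ n"
    unfolding fps_mult_nth using assms
    by (intro sum.cong arg_cong2[where f = "(*)"] refl prod_large_nth[of _ n]) auto
  finally show ?thesis by simp
qed

text \<open>A coefficient is final once \<open>F n\<close> contains the finitely many relevant
  elements of \<open>A\<close>. Any exhaustion is allowed, so each product can later be truncated in
  its natural way.\<close>

lemma tendsto_distinct_prod:
  assumes "\<And>n. finite (F n)" "\<And>n. F n \<subseteq> A" "0 \<notin> A"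
    and "\<And>m. m \<in> A \<Longrightarrow> \<forall>\<^sub>F n in sequentially. m \<in> F n"
  shows "(\<lambda>n. \<Prod>m\<in>F n. 1 + fps_X ^ m) \<longlonglongrightarrow> distinct_prod A"
proof (rule tendsto_fpsI)
  fix N
  have "\<forall>\<^sub>F n in sequentially. \<forall>m\<in>A \<inter> {1..N}. m \<in> F n"
    using assms(4) by (intro eventually_ball_finite) auto
  then show "\<forall>\<^sub>F n in sequentially. (\<Prod>m\<in>F n. 1 + fps_X ^ m) $ N = distinct_prod A $ N"
  proof eventually_elim
    case (elim n)
    have "F n \<inter> {..N} = A \<inter> {1..N}"
    proof (intro equalityI subsetI)
      fix x assume x: "x \<in> F n \<inter> {..N}"
      then have "x \<in> A" using assms(2) by blast
      moreover have "x \<noteq> 0" using \<open>x \<in> A\<close> assms(3) by metis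
      ultimately show "x \<in> A \<inter> {1..N}" using x by simp
    qed (use elim in auto)
    then show ?case
      using prod_truncate_nth[OF assms(1), of n N] by (simp add: distinct_prod_def)
  qed
qed

lemma tendsto_distinct_prod_canonical:
  "0 \<notin> A \<Longrightarrow> (\<lambda>n. \<Prod>m\<in>A \<inter> {1..n}. 1 + fps_X ^ m) \<longlonglongrightarrow> distinct_prod A"
  by (rule tendsto_distinct_prod) (auto simp: eventually_sequentially Suc_le_eq intro!: Nat.gr0I)

lemma distinct_prod_Un:
  assumes "0 \<notin> A" "0 \<notin> B" "A \<inter> B = {}"
  shows "distinct_prod (A \<union> B) = distinct_prod A * distinct_prod B"
proof (rule LIMSEQ_unique)
  show "(\<lambda>n. \<Prod>m\<in>(A \<union> B) \<inter> {1..n}. 1 + fps_X ^ m) \<longlonglongrightarrow> distinct_prod (A \<union> B)"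
    using assms by (intro tendsto_distinct_prod_canonical) auto
  have "(\<Prod>m\<in>(A \<union> B) \<inter> {1..n}. 1 + fps_X ^ m) = ((\<Prod>m\<in>A \<inter> {1..n}. 1 + fps_X ^ m)
      * (\<Prod>m\<in>B \<inter> {1..n}. 1 + fps_X ^ m) :: bit fps)" for n
    unfolding Int_Un_distrib2 using assms by (intro prod.union_disjoint) auto
  then show "(\<lambda>n. \<Prod>m\<in>(A \<union> B) \<inter> {1..n}. 1 + fps_X ^ m) \<longlonglongrightarrow> distinct_prod A * distinct_prod B"
    using assms by (simp only: tendsto_mult_fps tendsto_distinct_prod_canonical not_False_eq_True)
qed

lemma distinct_prod_UN:
  assumes "finite I" "\<And>i. i \<in> I \<Longrightarrow> 0 \<notin> A i"
    "\<And>i j. i \<in> I \<Longrightarrow> j \<in> I \<Longrightarrow> i \<noteq> j \<Longrightarrow> A i \<inter> A j = {}"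
  shows "distinct_prod (\<Union>i\<in>I. A i) = (\<Prod>i\<in>I. distinct_prod (A i))"
  using assms
proof (induction I rule: finite_induct)
  case empty
  show ?case by (simp add: distinct_prod_def fps_eq_iff)
next
  case (insert x I)
  have "A x \<inter> (\<Union>i\<in>I. A i) = {}"
    using insert.hyps(2) insert.prems(2)[of x] by (force simp: disjoint_iff)
  then have "distinct_prod (A x \<union> (\<Union>i\<in>I. A i)) = distinct_prod (A x) * distinct_prod (\<Union>i\<in>I. A i)"
    using insert.prems by (intro distinct_prod_Un) auto
  then show ?case using insert by simp
qed

text \<open>In characteristic 2, \<open>1 + q^(2 * m)\<close> is the square of
  \<open>1 + q^m\<close>.\<close>

lemma distinct_prod_double:
  assumes "0 \<notin> A"
  shows "distinct_prod ((*) 2 ` A) = (distinct_prod A)\<^sup>2"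
proof (rule LIMSEQ_unique)
  show "(\<lambda>n. \<Prod>m\<in>(*) 2 ` (A \<inter> {1..n}). 1 + fps_X ^ m) \<longlonglongrightarrow> distinct_prod ((*) 2 ` A)"
  proof (rule tendsto_distinct_prod)
    fix m assume "m \<in> (*) 2 ` A"
    then obtain x where x: "x \<in> A" "m = 2 * x" by blast
    have "m \<in> (*) 2 ` (A \<inter> {1..n})" if "n \<ge> x" for n
      using x that assms by (cases "x = 0") auto
    then show "\<forall>\<^sub>F n in sequentially. m \<in> (*) 2 ` (A \<inter> {1..n})"
      by (auto simp only: eventually_sequentially)
  qed (use assms in auto)
  have "(\<Prod>m\<in>(*) 2 ` (A \<inter> {1..n}). 1 + fps_X ^ m)
     = ((\<Prod>m\<in>A \<inter> {1..n}. 1 + fps_X ^ m) * (\<Prod>m\<in>A \<inter> {1..n}. 1 + fps_X ^ m) :: bit fps)" for n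
  proof -
    have "(\<Prod>m\<in>(*) 2 ` (A \<inter> {1..n}). 1 + fps_X ^ m) = ((\<Prod>m\<in>A \<inter> {1..n}. (1 + fps_X ^ m)\<^sup>2) :: bit fps)"
      unfolding fps_bit_square_one_plus
      by (subst prod.reindex) (auto simp: inj_on_def mult.commute[of 2] power_mult)
    then show ?thesis by (simp only: power2_eq_square prod.distrib)
  qed
  then show "(\<lambda>n. \<Prod>m\<in>(*) 2 ` (A \<inter> {1..n}). 1 + fps_X ^ m) \<longlonglongrightarrow> (distinct_prod A)\<^sup>2"
    using assms by (simp only: power2_eq_square tendsto_mult_fps tendsto_distinct_prod_canonical not_False_eq_True)
qed

lemma distinct_prod_nth_0 [simp]: "distinct_prod A $ 0 = 1"
  by (simp add: distinct_prod_def)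

section \<open>The triple product identity modulo 2\<close>

text \<open>The exponent of the \<open>k\<close>-th term
  \<open>a^(k (k + 1) / 2) * b^(k (k - 1) / 2)\<close> of \<open>f(a, b)\<close> at
  \<open>a = q^u\<close>, \<open>b = q^v\<close>. Both triangular numbers are non-negative, so
  \<open>nat\<close> cuts off nothing.\<close>

definition theta_exp :: "nat \<Rightarrow> nat \<Rightarrow> int \<Rightarrow> nat" where
  "theta_exp u v k = nat (int u * (k * (k + 1) div 2) + int v * (k * (k - 1) div 2))"

text \<open>The reduction modulo 2 of Ramanujan's theta function \<open>f(q\<^sup>u, q\<^sup>v)\<close>.\<close>
definition theta :: "nat \<Rightarrow> nat \<Rightarrow> bit fps" where
  "theta u v = Abs_fps (\<lambda>n. of_nat (card {k. theta_exp u v k = n}))"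

lemma triangular_int_nonneg: "0 \<le> k * (k + 1) div (2::int)" "0 \<le> k * (k - 1) div (2::int)"
proof -
  have "0 \<le> k * (k + 1)" "0 \<le> k * (k - 1)"
    by (auto simp: zero_le_mult_iff)
  then show "0 \<le> k * (k + 1) div (2::int)" "0 \<le> k * (k - 1) div (2::int)"
    by auto
qed

lemma int_theta_exp:
  "int (theta_exp u v k) = int u * (k * (k + 1) div 2) + int v * (k * (k - 1) div 2)"
  unfolding theta_exp_def using triangular_int_nonneg[of k] by simp

lemma two_theta_exp:
  "2 * int (theta_exp u v k) = int u * (k * (k + 1)) + int v * (k * (k - 1))"
proof -
  have "2 * (k * (k + 1) div 2) = k * (k + 1)" "2 * (k * (k - 1) div 2) = k * (k - 1)"
    by (simp_all add: even_mult_iff dvd_mult_div_cancel)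
  then show ?thesis
    unfolding int_theta_exp by (metis (no_types, opaque_lifting) distrib_left mult.left_commute)
qed

lemma theta_exp_uminus: "theta_exp v u (- k) = theta_exp u v k"
proof -
  have "2 * int (theta_exp v u (- k)) = 2 * int (theta_exp u v k)"
    unfolding two_theta_exp by (simp add: algebra_simps)
  then show ?thesis by simp
qed

lemma theta_exp_add_1:
  "int (theta_exp u v (k + 1)) = int (theta_exp u v k) + int (u + v) * k + int u"
proof -
  have "2 * int (theta_exp u v (k + 1)) = 2 * (int (theta_exp u v k) + int (u + v) * k + int u)"
    unfolding two_theta_exp distrib_left by (simp add: algebra_simps)
  then show ?thesis by simp
qed

lemma abs_le_theta_exp:
  assumes "0 < u" "0 < v"
  shows "\<bar>k\<bar> \<le> int (theta_exp u v k)"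
proof -
  have 1: "k * (k + 1) \<le> int u * (k * (k + 1))" "k * (k - 1) \<le> int v * (k * (k - 1))"
  proof -
    have "0 \<le> k * (k + 1)" "0 \<le> k * (k - 1)"
      by (auto simp: zero_le_mult_iff)
    then show "k * (k + 1) \<le> int u * (k * (k + 1))" "k * (k - 1) \<le> int v * (k * (k - 1))"
      using assms mult_right_mono[of 1 "int u"] mult_right_mono[of 1 "int v"] by auto
  qed
  have "\<bar>k\<bar> * 1 \<le> \<bar>k\<bar> * \<bar>k\<bar>"
    by (cases "k = 0") (simp, rule mult_left_mono, auto)
  then have "2 * \<bar>k\<bar> \<le> k * (k + 1) + k * (k - 1)"
    by (simp add: algebra_simps)
  then show ?thesis using 1 two_theta_exp[of u v k] by linarith
qed

section \<open>A finite form of the triple product\<close>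

definition qfact :: "nat \<Rightarrow> nat \<Rightarrow> bit fps" where
  "qfact w n = (\<Prod>m\<in>{1..n}. 1 + fps_X ^ (w * m))"

text \<open>The Gaussian binomial coefficient of \<open>i + j\<close> over \<open>i\<close> in the
  base \<open>q^w\<close>. The value 0 at negative arguments lets summation ranges be
  enlarged.\<close>

definition qbinom :: "nat \<Rightarrow> int \<Rightarrow> int \<Rightarrow> bit fps" where
  "qbinom w i j = (if i < 0 \<or> j < 0 then 0
     else qfact w (nat (i + j)) * inverse (qfact w (nat i)) * inverse (qfact w (nat j)))"

lemma qfact_nth_0: "0 < w \<Longrightarrow> qfact w n $ 0 = 1"
  by (induction n) (simp_all add: qfact_def prod.nat_ivl_Suc' fps_mult_nth_0)

lemma qfact_Suc: "qfact w (Suc n) = qfact w n * (1 + fps_X ^ (w * Suc n))"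
  by (simp add: qfact_def prod.nat_ivl_Suc' mult.commute)

lemma qfact_inverse: "0 < w \<Longrightarrow> qfact w n * inverse (qfact w n) = 1"
  by (rule inverse_mult_eq_1') (simp add: qfact_nth_0)

lemma qfact_inverse_Suc:
  assumes "0 < w"
  shows "inverse (qfact w n) = (1 + fps_X ^ (w * Suc n)) * inverse (qfact w (Suc n))"
proof -
  have "inverse (qfact w n) * 1 = inverse (qfact w n) * (qfact w (Suc n) * inverse (qfact w (Suc n)))"
    by (simp only: qfact_inverse[OF assms])
  also have "\<dots> = (qfact w n * inverse (qfact w n)) * ((1 + fps_X ^ (w * Suc n)) * inverse (qfact w (Suc n)))"
    by (simp only: qfact_Suc[of w n] mult_ac)
  finally show ?thesis by (simp add: qfact_inverse[OF assms])
qed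

text \<open>With \<open>x = q^(w i)\<close> and \<open>y = q^(w j)\<close> the rule is
  \<open>1 + x y = (1 + y) + y (1 + x)\<close> modulo 2. At \<open>i = j = 0\<close> it would read
  \<open>1 = 0\<close>.\<close>

lemma qbinom_Pascal:
  assumes "0 < w" "0 < i + j"
  shows "qbinom w i j = qbinom w i (j - 1) + fps_X ^ (w * nat j) * qbinom w (i - 1) j"
proof (cases "i < 0 \<or> j < 0")
  case True
  then show ?thesis by (auto simp: qbinom_def)
next
  case False
  show ?thesis
  proof (cases "i = 0 \<or> j = 0")
    case True
    then show ?thesis using False assms
      by (auto simp: qbinom_def qfact_inverse)
  next
    case nz: False
    obtain a b where ab: "i = int (Suc a)" "j = int (Suc b)"
    proof
      show "i = int (Suc (nat (i - 1)))" "j = int (Suc (nat (j - 1)))"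
        using False nz by auto
    qed
    have n: "nat (i + j) = Suc (Suc (a + b))" "nat i = Suc a" "nat j = Suc b" "nat (i + (j - 1)) = Suc (a + b)"
      "nat (i - 1 + j) = Suc (a + b)" "nat (i - 1) = a" "nat (j - 1) = b"
      "\<not> i < 0" "\<not> j < 0" "\<not> i - 1 < 0" "\<not> j - 1 < 0"
      using ab by simp_all
    let ?A = "inverse (qfact w (Suc a))" and ?B = "inverse (qfact w (Suc b))"
    let ?x = "fps_X ^ (w * Suc a) :: bit fps" and ?y = "fps_X ^ (w * Suc b) :: bit fps"
    have xy: "fps_X ^ (w * Suc (Suc (a + b))) = ?x * ?y"
      by (simp add: power_add[symmetric] algebra_simps)
    have "(1 + ?y) + ?y * (1 + ?x) = 1 + (?y + ?y) + ?x * ?y"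
      by (simp only: algebra_simps mult_1_left mult_1_right)
    then have id: "(1 + ?y) + ?y * (1 + ?x) = 1 + ?x * ?y"
      by (simp only: fps_bit_add_self add_0_right)
    have "qbinom w i j = qfact w (Suc (a + b)) * (1 + ?x * ?y) * ?A * ?B"
      by (simp only: qbinom_def n if_False simp_thms qfact_Suc[of w "Suc (a + b)"] xy)
    also have "\<dots> = qfact w (Suc (a + b)) * ?A * ((1 + ?y) * ?B) + ?y * (qfact w (Suc (a + b)) * ((1 + ?x) * ?A) * ?B)"
      unfolding id[symmetric] by (simp only: algebra_simps)
    also have "\<dots> = qbinom w i (j - 1) + fps_X ^ (w * nat j) * qbinom w (i - 1) j"
      by (simp only: qbinom_def n if_False simp_thms qfact_inverse_Suc[OF assms(1), of a] qfact_inverse_Suc[OF assms(1), of b])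
    finally show ?thesis .
  qed
qed

text \<open>The sum side of the triple product with \<open>a\<close> factors of one kind and
  \<open>b\<close> of the other; separate bounds permit an induction on each.\<close>

definition bounded_theta :: "nat \<Rightarrow> nat \<Rightarrow> nat \<Rightarrow> nat \<Rightarrow> bit fps" where
  "bounded_theta u v a b =
     (\<Sum>k\<in>{- int a..int b}. fps_X ^ theta_exp u v k * qbinom (u + v) (int a + k) (int b - k))"

lemma qbinom_commute: "qbinom w i j = qbinom w j i"
  by (simp add: qbinom_def add.commute mult_ac)

lemma bounded_theta_swap: "bounded_theta u v a b = bounded_theta v u b a"
  unfolding bounded_theta_def
  by (rule sum.reindex_bij_witness[of _ uminus uminus])
    (auto simp: theta_exp_uminus qbinom_commute add.commute)

text \<open>Pascal's rule splits off the old sum; the rest, after a shift of \<open>k\<close> by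
  one, is the old sum times a fixed monomial.\<close>

lemma bounded_theta_Suc:
  assumes "0 < u + v"
  shows "bounded_theta u v a (Suc b) = bounded_theta u v a b * (1 + fps_X ^ (u + (u + v) * b))"
proof -
  let ?w = "u + v"
  let ?q = "\<lambda>k. fps_X ^ theta_exp u v k :: bit fps"
  let ?S = "{- int a..int (Suc b)}"
  have "bounded_theta u v a (Suc b) = (\<Sum>k\<in>?S. ?q k * qbinom ?w (int a + k) (int b - k)
      + ?q k * (fps_X ^ (?w * nat (int (Suc b) - k)) * qbinom ?w (int a + k - 1) (int (Suc b) - k)))"
    unfolding bounded_theta_def
    by (intro sum.cong refl, subst qbinom_Pascal[OF assms]) (simp_all add: distrib_left)
  also have "\<dots> = (\<Sum>k\<in>?S. ?q k * qbinom ?w (int a + k) (int b - k))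
      + (\<Sum>k\<in>?S. ?q k * (fps_X ^ (?w * nat (int (Suc b) - k)) * qbinom ?w (int a + k - 1) (int (Suc b) - k)))"
    by (rule sum.distrib)
  \<comment> \<open>The term at \<open>k = b + 1\<close> vanishes because its last argument is
    \<open>-1\<close>.\<close>
  also have "(\<Sum>k\<in>?S. ?q k * qbinom ?w (int a + k) (int b - k)) = bounded_theta u v a b"
    unfolding bounded_theta_def
    by (rule sum.mono_neutral_right) (auto simp: qbinom_def)
  also have "(\<Sum>k\<in>?S. ?q k * (fps_X ^ (?w * nat (int (Suc b) - k)) * qbinom ?w (int a + k - 1) (int (Suc b) - k)))
     = (\<Sum>k\<in>{1 - int a..int (Suc b)}. ?q k * (fps_X ^ (?w * nat (int (Suc b) - k)) * qbinom ?w (int a + k - 1) (int (Suc b) - k)))"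
    by (rule sum.mono_neutral_right) (auto simp: qbinom_def)
  also have "\<dots> = (\<Sum>k\<in>{- int a..int b}. (?q k * qbinom ?w (int a + k) (int b - k)) * fps_X ^ (u + ?w * b))"
  proof (rule sum.reindex_bij_witness[of _ "\<lambda>k. k + 1" "\<lambda>k. k - 1"], goal_cases)
    case (5 k)
    \<comment> \<open>Passing from \<open>k - 1\<close> to \<open>k\<close> adds
      \<open>(u + v) * (k - 1) + u\<close> to the exponent; with
      \<open>(u + v) * (b + 1 - k)\<close> this makes an amount independent of
      \<open>k\<close>.\<close>
    have "int (theta_exp u v k + ?w * nat (int (Suc b) - k)) = int (theta_exp u v (k - 1) + (u + ?w * b))"
      using 5 theta_exp_add_1[of u v "k - 1"] by (simp add: algebra_simps)
    then have "theta_exp u v k + ?w * nat (int (Suc b) - k) = theta_exp u v (k - 1) + (u + ?w * b)"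
      by (simp only: of_nat_eq_iff)
    then have *: "?q k * fps_X ^ (?w * nat (int (Suc b) - k)) = ?q (k - 1) * fps_X ^ (u + ?w * b)"
      by (simp only: power_add[symmetric])
    have "int a + (k - 1) = int a + k - 1" "int b - (k - 1) = int (Suc b) - k"
      by simp_all
    then show ?case
      by (simp only: mult.assoc[symmetric] *) (simp only: mult_ac)
  qed auto
  finally show ?thesis
    by (simp add: bounded_theta_def sum_distrib_right distrib_left)
qed

lemma bounded_theta_eq_prod:
  assumes "0 < u + v"
  shows "bounded_theta u v a b =
    (\<Prod>j<a. 1 + fps_X ^ (v + (u + v) * j)) * (\<Prod>j<b. 1 + fps_X ^ (u + (u + v) * j))"
proof -
  have 0: "bounded_theta u v 0 0 = 1" for u v
    by (simp add: bounded_theta_def theta_exp_def qbinom_def qfact_def)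
  have "bounded_theta u v a 0 = (\<Prod>j<a. 1 + fps_X ^ (v + (u + v) * j))"
  proof (induction a)
    case (Suc a)
    show ?case using bounded_theta_Suc[of v u 0 a] assms Suc
      by (simp add: bounded_theta_swap[of u v _ 0] add.commute)
  qed (simp add: 0)
  then show ?thesis
    by (induction b) (simp_all add: bounded_theta_Suc[OF assms] mult_ac)
qed

section \<open>Passage to the infinite product\<close>

definition euler :: "nat \<Rightarrow> bit fps" where
  "euler d = distinct_prod {m. 0 < m \<and> d dvd m}"

lemma euler_nth_0 [simp]: "euler d $ 0 = 1"
  by (simp add: euler_def)

lemma euler_nonzero [simp]: "euler d \<noteq> 0"
  by (metis euler_nth_0 fps_zero_nth zero_neq_one)

lemma tendsto_qfact:
  assumes "0 < w"
  shows "qfact w \<longlonglongrightarrow> euler w"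
proof -
  have *: "qfact w n = (\<Prod>m\<in>(*) w ` {1..n}. 1 + fps_X ^ m)" for n
    unfolding qfact_def using assms by (subst prod.reindex) (auto simp: inj_on_def)
  have "(\<lambda>n. \<Prod>m\<in>(*) w ` {1..n}. 1 + fps_X ^ m) \<longlonglongrightarrow> euler w"
    unfolding euler_def
  proof (rule tendsto_distinct_prod)
    fix m assume "m \<in> {m. 0 < m \<and> w dvd m}"
    then obtain x where x: "0 < x" "m = w * x" by (auto elim!: dvdE)
    have "m \<in> (*) w ` {1..n}" if "n \<ge> x" for n
      using x that by auto
    then show "\<forall>\<^sub>F n in sequentially. m \<in> (*) w ` {1..n}"
      by (auto simp only: eventually_sequentially)
  qed (use assms in auto)
  then show ?thesis unfolding * .
qed

text \<open>The three q-factorials all tend to \<open>euler w\<close>, so the binomial coefficient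
  tends to its inverse.\<close>

lemma tendsto_qbinom:
  assumes "0 < w"
  shows "(\<lambda>n. euler w * qbinom w (int n + k) (int n - k)) \<longlonglongrightarrow> 1"
proof -
  have lim: "filterlim (\<lambda>n. nat (int n + c)) sequentially sequentially" for c
    unfolding filterlim_at_top eventually_sequentially
  proof
    fix Z
    have "Z \<le> nat (int n + c)" if "Z + nat \<bar>c\<bar> \<le> n" for n
      using that by linarith
    then show "\<exists>N. \<forall>n\<ge>N. Z \<le> nat (int n + c)" by blast
  qed
  have 1: "(\<lambda>n. qfact w (nat (int n + c))) \<longlonglongrightarrow> euler w" for c
    using filterlim_compose[OF tendsto_qfact[OF assms] lim] .
  have 2: "(\<lambda>n. qfact w (2 * n)) \<longlonglongrightarrow> euler w"
    by (rule filterlim_compose[OF tendsto_qfact[OF assms]])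
      (auto intro!: filterlim_subseq strict_monoI)
  have "(\<lambda>n. euler w * (qfact w (2 * n) * inverse (qfact w (nat (int n + k))) * inverse (qfact w (nat (int n + (- k))))))
      \<longlonglongrightarrow> euler w * (euler w * inverse (euler w) * inverse (euler w))"
    by (intro tendsto_mult_fps tendsto_const 1 2 tendsto_inverse_fps) auto
  also have "euler w * (euler w * inverse (euler w) * inverse (euler w)) = 1"
    by (simp add: inverse_mult_eq_1')
  finally show ?thesis
  proof (rule Lim_transform_eventually)
    show "\<forall>\<^sub>F n in sequentially. euler w * (qfact w (2 * n) * inverse (qfact w (nat (int n + k))) *
        inverse (qfact w (nat (int n + (- k))))) = euler w * qbinom w (int n + k) (int n - k)"
      using eventually_ge_at_top[of "nat \<bar>k\<bar>"]
      by eventually_elim (auto simp: qbinom_def nat_mult_distrib)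
  qed
qed

text \<open>By \<open>abs_le_theta_exp\<close> only the terms with \<open>-N \<le> k \<le> N\<close>
  reach the coefficient of \<open>q^N\<close>, so the limit is taken in finitely many terms.\<close>

lemma theta_limit:
  assumes "0 < u" "0 < v"
  shows "(\<lambda>n. euler (u + v) * bounded_theta u v n n) \<longlonglongrightarrow> theta u v"
proof (rule tendsto_fpsI)
  fix N
  let ?w = "u + v"
  let ?t = "\<lambda>n k. fps_X ^ theta_exp u v k * (euler ?w * qbinom ?w (int n + k) (int n - k))"
  let ?I = "{- int N..int N}"
  have "\<forall>\<^sub>F n in sequentially. \<forall>k\<in>?I. ?t n k $ N = (fps_X ^ theta_exp u v k * 1) $ N"
  proof (rule eventually_ball_finite)
    have "(\<lambda>n. ?t n k) \<longlonglongrightarrow> fps_X ^ theta_exp u v k * 1" for k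
      using assms by (intro tendsto_mult_fps[OF tendsto_const] tendsto_qbinom) simp
    then show "\<forall>k\<in>?I. \<forall>\<^sub>F n in sequentially. ?t n k $ N = (fps_X ^ theta_exp u v k * 1) $ N"
      by (simp add: tendsto_fps_iff)
  qed simp
  then show "\<forall>\<^sub>F n in sequentially. (euler ?w * bounded_theta u v n n) $ N = theta u v $ N"
    using eventually_ge_at_top[of N]
  proof eventually_elim
    case (elim n)
    have "(euler ?w * bounded_theta u v n n) $ N = (\<Sum>k\<in>{- int n..int n}. ?t n k $ N)"
      by (simp add: bounded_theta_def sum_distrib_left fps_sum_nth mult_ac)
    also have "\<dots> = (\<Sum>k\<in>?I. ?t n k $ N)"
    proof (rule sum.mono_neutral_right)
      show "\<forall>k\<in>{- int n..int n} - ?I. ?t n k $ N = 0"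
      proof
        fix k assume "k \<in> {- int n..int n} - ?I"
        then have "N < theta_exp u v k" using abs_le_theta_exp[OF assms, of k] by auto
        then show "?t n k $ N = 0" by (simp add: fps_X_power_mult_nth)
      qed
    qed (use elim in auto)
    also have "\<dots> = (\<Sum>k\<in>?I. if theta_exp u v k = N then 1 else 0)"
      using elim by (intro sum.cong) (auto simp: fps_X_power_nth)
    also have "\<dots> = of_nat (card {k \<in> ?I. theta_exp u v k = N})"
      by (simp add: sum.If_cases Int_def)
    also have "{k \<in> ?I. theta_exp u v k = N} = {k. theta_exp u v k = N}"
    proof (intro Collect_cong iffI conjI)
      fix k assume "theta_exp u v k = N"
      then show "k \<in> ?I" using abs_le_theta_exp[OF assms, of k] by auto
    qed auto
    finally show ?case by (simp add: theta_def)
  qed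
qed

text \<open>The limit of the finite form with \<open>a = b = n\<close>; the factor
  \<open>euler (u + v)\<close> clears the limit of the Gaussian binomials.\<close>

theorem theta_triple_product:
  assumes "0 < u" "0 < v" "u \<noteq> v"
  shows "theta u v = euler (u + v) * distinct_prod {m. m mod (u + v) = u} * distinct_prod {m. m mod (u + v) = v}"
proof (rule LIMSEQ_unique[OF theta_limit[OF assms(1,2)]])
  let ?w = "u + v"
  have *: "(\<lambda>n. \<Prod>j<n. 1 + fps_X ^ (c + ?w * j)) \<longlonglongrightarrow> distinct_prod {m. m mod ?w = c}" if "0 < c" "c < ?w" for c
  proof -
    have "(\<Prod>j<n. 1 + fps_X ^ (c + ?w * j)) = ((\<Prod>m\<in>(\<lambda>j. c + ?w * j) ` {..<n}. 1 + fps_X ^ m) :: bit fps)" for n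
      using that by (subst prod.reindex) (auto simp: inj_on_def)
    moreover have "(\<lambda>n. \<Prod>m\<in>(\<lambda>j. c + ?w * j) ` {..<n}. 1 + fps_X ^ m) \<longlonglongrightarrow> distinct_prod {m. m mod ?w = c}"
    proof (rule tendsto_distinct_prod)
      fix m assume m: "m \<in> {m. m mod ?w = c}"
      have "m \<in> (\<lambda>j. c + ?w * j) ` {..<n}" if "n \<ge> Suc (m div ?w)" for n
        using that m by (intro image_eqI[of _ _ "m div ?w"]) (use mod_mult_div_eq[of m ?w] in auto)
      then show "\<forall>\<^sub>F n in sequentially. m \<in> (\<lambda>j. c + ?w * j) ` {..<n}"
        by (auto simp only: eventually_sequentially)
    qed (use that in auto)
    ultimately show ?thesis by simp
  qed
  have "(\<lambda>n. euler ?w * (\<Prod>j<n. 1 + fps_X ^ (u + ?w * j)) * (\<Prod>j<n. 1 + fps_X ^ (v + ?w * j)))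
    \<longlonglongrightarrow> euler ?w * distinct_prod {m. m mod ?w = u} * distinct_prod {m. m mod ?w = v}"
    using assms by (intro tendsto_mult_fps tendsto_const *) auto
  then show "(\<lambda>n. euler ?w * bounded_theta u v n n) \<longlonglongrightarrow> euler ?w * distinct_prod {m. m mod ?w = u} * distinct_prod {m. m mod ?w = v}"
    using assms by (simp add: bounded_theta_eq_prod mult_ac)
qed

section \<open>Euler products as theta series\<close>

lemma euler_double: "euler (2 * d) = (euler d)\<^sup>2"
proof -
  have "{m. 0 < m \<and> 2 * d dvd m} = (*) 2 ` {m. 0 < m \<and> d dvd m}"
    by (auto elim!: dvdE simp: image_iff)
  then show ?thesis unfolding euler_def by (simp add: distinct_prod_double)
qed

lemma dvd_iff_mod_multiple:
  assumes "0 < (K::nat)"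
  shows "d dvd m \<longleftrightarrow> (\<exists>c<K. m mod (K * d) = c * d)"
proof
  assume "d dvd m"
  then obtain c where "m = c * d" by (metis dvd_def mult.commute)
  then have "m mod (K * d) = (c mod K) * d"
    by (simp add: mod_mult_mult2)
  then show "\<exists>c<K. m mod (K * d) = c * d" using assms mod_less_divisor by blast
next
  assume "\<exists>c<K. m mod (K * d) = c * d"
  then have "d dvd m mod (K * d)" by auto
  then show "d dvd m" by (simp add: dvd_mod_iff)
qed

text \<open>The multiples of \<open>d\<close> split into odd and even ones, and the even ones
  contribute \<open>euler (2 * d) = (euler d)^2\<close>; one factor \<open>euler d\<close>
  cancels.\<close>

lemma distinct_prod_odd_multiples:
  assumes "0 < d"
  shows "distinct_prod {m. m mod (2 * d) = d} * euler d = 1"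
proof -
  have "d dvd m \<longleftrightarrow> m mod (2 * d) = d \<or> 2 * d dvd m" for m
    unfolding dvd_iff_mod_multiple[of 2 d, simplified] by (auto simp: less_2_cases_iff)
  then have "{m. 0 < m \<and> d dvd m} = {m. m mod (2 * d) = d} \<union> {m. 0 < m \<and> 2 * d dvd m}"
    using assms by (auto intro!: gr0I)
  then have "euler d = distinct_prod ({m. m mod (2 * d) = d} \<union> {m. 0 < m \<and> 2 * d dvd m})"
    by (simp add: euler_def)
  also have "\<dots> = distinct_prod {m. m mod (2 * d) = d} * euler (2 * d)"
    unfolding euler_def using assms by (intro distinct_prod_Un) auto
  also have "\<dots> = euler d * (distinct_prod {m. m mod (2 * d) = d} * euler d)"
    unfolding euler_double power2_eq_square by (simp only: mult_ac)
  finally have "euler d * 1 = euler d * (distinct_prod {m. m mod (2 * d) = d} * euler d)"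
    by simp
  then show ?thesis by (simp only: mult_cancel_left euler_nonzero) simp
qed

text \<open>The pentagonal number theorem modulo 2: the multiples of \<open>d\<close> fill the
  classes \<open>0\<close>, \<open>d\<close>, \<open>2 * d\<close> modulo \<open>3 * d\<close>, as
  in the triple product at \<open>u = 2 * d\<close>, \<open>v = d\<close>.\<close>

lemma euler_eq_theta:
  assumes "0 < d"
  shows "euler d = theta (2 * d) d"
proof -
  have "{m. 0 < m \<and> d dvd m} = {m. 0 < m \<and> 3 * d dvd m} \<union> {m. m mod (3 * d) = 2 * d} \<union> {m. m mod (3 * d) = d}"
  proof -
    have *: "(\<exists>c<3. P c) \<longleftrightarrow> P 0 \<or> P 1 \<or> P 2" for P :: "nat \<Rightarrow> bool"
      by (auto simp: numeral_3_eq_3 numeral_2_eq_2 less_Suc_eq)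
    have "d dvd m \<longleftrightarrow> 3 * d dvd m \<or> m mod (3 * d) = 2 * d \<or> m mod (3 * d) = d" for m
      using dvd_iff_mod_multiple[of 3 d m] unfolding * by (auto simp only: dvd_eq_mod_eq_0[of "3 * d" m] mult_0 mult_1 zero_less_numeral)
    then show ?thesis using assms by (auto intro!: gr0I)
  qed
  then have "euler d = distinct_prod ({m. 0 < m \<and> 3 * d dvd m} \<union> {m. m mod (3 * d) = 2 * d} \<union> {m. m mod (3 * d) = d})"
    by (simp add: euler_def)
  also have "\<dots> = distinct_prod ({m. 0 < m \<and> 3 * d dvd m} \<union> {m. m mod (3 * d) = 2 * d}) * distinct_prod {m. m mod (3 * d) = d}"
    using assms by (intro distinct_prod_Un) auto
  also have "distinct_prod ({m. 0 < m \<and> 3 * d dvd m} \<union> {m. m mod (3 * d) = 2 * d}) = euler (3 * d) * distinct_prod {m. m mod (3 * d) = 2 * d}"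
    unfolding euler_def using assms by (intro distinct_prod_Un) auto
  finally show ?thesis using assms theta_triple_product[of "2 * d" d] by simp
qed

text \<open>Jacobi's formula for the cube modulo 2: the classes \<open>d\<close> and
  \<open>3 * d\<close> modulo \<open>4 * d\<close> form the odd multiples of \<open>d\<close>, whose
  product is the inverse of \<open>euler d\<close>, while \<open>euler (4 * d)\<close> is its fourth
  power.\<close>

lemma euler_cube_eq_theta:
  assumes "0 < d"
  shows "euler d ^ 3 = theta (3 * d) d"
proof -
  have 4: "m mod (4 * d) = d \<or> m mod (4 * d) = 3 * d \<longleftrightarrow> m mod (2 * d) = d" for m
  proof -
    have "m mod (4 * d) mod (2 * d) = m mod (2 * d)"
      by (simp add: mod_mod_cancel)
    moreover have "m mod (4 * d) < 4 * d" using assms by simp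
    moreover have "x mod (2 * d) = d \<longleftrightarrow> x = d \<or> x = 3 * d" if "x < 4 * d" for x
    proof (cases "x < 2 * d")
      case True then show ?thesis using assms by auto
    next
      case False
      then have "x mod (2 * d) = x - 2 * d" using that assms by (simp add: le_mod_geq)
      then show ?thesis using False assms by auto
    qed
    ultimately show ?thesis by metis
  qed
  have "theta (3 * d) d = euler (4 * d) * (distinct_prod {m. m mod (4 * d) = 3 * d} * distinct_prod {m. m mod (4 * d) = d})"
    using theta_triple_product[of "3 * d" d] assms by (simp add: mult.assoc)
  also have "distinct_prod {m. m mod (4 * d) = 3 * d} * distinct_prod {m. m mod (4 * d) = d} = distinct_prod ({m. m mod (4 * d) = 3 * d} \<union> {m. m mod (4 * d) = d})"
    using assms by (intro distinct_prod_Un[symmetric]) auto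
  also have "{m. m mod (4 * d) = 3 * d} \<union> {m. m mod (4 * d) = d} = {m. m mod (2 * d) = d}"
    using 4 by auto
  also have "euler (4 * d) = euler d ^ 4"
    using euler_double[of "2 * d"] euler_double[of d] by (simp flip: power_mult)
  finally have "theta (3 * d) d = euler d ^ 3 * (distinct_prod {m. m mod (2 * d) = d} * euler d)"
    by (simp add: power4_eq_xxxx power3_eq_cube mult_ac)
  then show ?thesis by (simp add: distinct_prod_odd_multiples[OF assms])
qed

lemma prod_odd_below_26:
  fixes r :: "nat \<Rightarrow> 'a::comm_monoid_mult"
  shows "(\<Prod>c\<in>{1,3,5,7,9,11,13,15,17,19,21,23,25}. r c) = (\<Prod>i\<in>{1..6}. r (13 + 2 * i) * r (13 - 2 * i)) * r 13"
proof -
  have "{1..6::nat} = {1,2,3,4,5,6}" by auto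
  then show ?thesis by (simp add: mult_ac)
qed

text \<open>The classes \<open>13 + 2 i\<close> and \<open>13 - 2 i\<close> modulo 26, together with
  13, are all the odd ones. The product over the odd numbers is the inverse of
  \<open>euler 1\<close>, that over the class 13 the inverse of \<open>euler 13\<close>; there
  remain six factors \<open>euler 26 = (euler 13)^2\<close>.\<close>

lemma prod_theta_13:
  "(\<Prod>i\<in>{1..6}. theta (13 + 2 * i) (13 - 2 * i)) * euler 1 = euler 13 ^ 13"
proof -
  let ?r = "\<lambda>c. distinct_prod {m. m mod 26 = c}"
  let ?T = "\<Prod>i\<in>{1..6::nat}. theta (13 + 2 * i) (13 - 2 * i)"
  let ?C = "\<Prod>i\<in>{1..6::nat}. ?r (13 + 2 * i) * ?r (13 - 2 * i)"
  have "theta (13 + 2 * i) (13 - 2 * i) = euler 26 * (?r (13 + 2 * i) * ?r (13 - 2 * i))" if "i \<in> {1..6}" for i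
  proof -
    have "13 + 2 * i \<noteq> 13 - 2 * i" using that by (simp, arith)
    then show ?thesis
      using theta_triple_product[of "13 + 2 * i" "13 - 2 * i"] that by (simp add: mult.assoc)
  qed
  then have "?T = (\<Prod>i\<in>{1..6}. euler 26 * (?r (13 + 2 * i) * ?r (13 - 2 * i)))"
    by (intro prod.cong) auto
  also have "\<dots> = euler 26 ^ 6 * ?C"
    by (simp only: prod.distrib) simp
  finally have T: "?T = euler 26 ^ 6 * ?C" .
  have odd: "{m::nat. m mod 2 = 1} = (\<Union>c\<in>{1,3,5,7,9,11,13,15,17,19,21,23,25}. {m. m mod 26 = c})"
  proof -
    have 26: "{1,3,5,7,9,11,13,15,17,19,21,23,25} = {c::nat. c < 26 \<and> c mod 2 = 1}"
    proof -
      have "{c::nat. c < 26 \<and> c mod 2 = 1} = set (filter (\<lambda>c. c mod 2 = 1) [0..<26])" by auto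
      also have "\<dots> = {1,3,5,7,9,11,13,15,17,19,21,23,25}" by code_simp
      finally show ?thesis by (rule sym)
    qed
    have "m mod 26 mod 2 = m mod 2" for m :: nat by (rule mod_mod_cancel) simp
    then show ?thesis unfolding 26 by auto
  qed
  have "distinct_prod {m. m mod 2 = 1} = (\<Prod>c\<in>{1,3,5,7,9,11,13,15,17,19,21,23,25}. ?r c)"
    unfolding odd by (intro distinct_prod_UN) auto
  also have "\<dots> = ?C * ?r 13"
    by (rule prod_odd_below_26)
  finally have "distinct_prod {m. m mod 2 = 1} = ?C * ?r 13" .
  moreover have "distinct_prod {m. m mod 2 = 1} * euler 1 = 1" using distinct_prod_odd_multiples[of 1] by simp
  ultimately have 1: "(?C * ?r 13) * euler 1 = 1" by (simp only:)
  have 13: "?r 13 * euler 13 = 1" using distinct_prod_odd_multiples[of 13] by simp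
  \<comment> \<open>Both \<open>c * a\<close> and \<open>b\<close> are the inverse of
    \<open>r\<close>.\<close>
  have "c * a = b" if "(c * r) * a = 1" "r * b = 1" for a b c r :: "bit fps"
  proof -
    have "c * a = c * a * (r * b)" using that(2) by simp
    also have "\<dots> = ((c * r) * a) * b" by (simp only: mult_ac)
    finally show ?thesis using that(1) by simp
  qed
  from this[OF 1 13] have "?C * euler 1 = euler 13" .
  then have "?T * euler 1 = euler 26 ^ 6 * euler 13" unfolding T by (simp only: mult.assoc)
  also have "euler 26 = euler 13 ^ 2" using euler_double[of 13] by simp
  finally show ?thesis by (simp flip: power_mult power_Suc2)
qed

section \<open>Generating functions and the binary forms\<close>

text \<open>The terms at \<open>i\<close> and \<open>n - i\<close> cancel modulo 2; only a middle
  one survives.\<close>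

lemma sum_bit_symmetric:
  fixes h :: "nat \<Rightarrow> bit"
  assumes "\<And>i. i \<le> n \<Longrightarrow> h (n - i) = h i"
  shows "(\<Sum>i=0..n. h i) = (if even n then h (n div 2) else 0)"
proof -
  let ?L = "{i. 2 * i < n}" and ?M = "{i. 2 * i = n}" and ?R = "{i. i \<le> n \<and> n < 2 * i}"
  have fin: "finite ?L" "finite ?M" "finite ?R"
    by (rule finite_subset[of _ "{0..n}"]; auto)+
  have "{0..n} = (?L \<union> ?M) \<union> ?R" by auto
  then have "(\<Sum>i=0..n. h i) = (\<Sum>i\<in>?L \<union> ?M. h i) + (\<Sum>i\<in>?R. h i)"
    using fin by (simp only:) (rule sum.union_disjoint; auto)
  also have "(\<Sum>i\<in>?L \<union> ?M. h i) = (\<Sum>i\<in>?L. h i) + (\<Sum>i\<in>?M. h i)"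
    using fin by (intro sum.union_disjoint) auto
  also have "(\<Sum>i\<in>?R. h i) = (\<Sum>i\<in>?L. h i)"
    by (rule sum.reindex_bij_witness[of _ "\<lambda>i. n - i" "\<lambda>i. n - i"]) (auto simp: assms)
  also have "(\<Sum>i\<in>?L. h i) + (\<Sum>i\<in>?M. h i) + (\<Sum>i\<in>?L. h i) = (\<Sum>i\<in>?M. h i)"
    by (simp only: add.commute[of "\<Sum>i\<in>?L. h i" "\<Sum>i\<in>?M. h i"] add.assoc bit_add_self add_0_right)
  also have "?M = (if even n then {n div 2} else {})" by auto
  finally show ?thesis by simp
qed

lemma fps_bit_square_nth: "(g\<^sup>2) $ n = (if even n then g $ (n div 2) else 0)" for g :: "bit fps"
proof -
  have "(g\<^sup>2) $ n = (if even n then g $ (n div 2) * g $ (n - n div 2) else 0)"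
    unfolding power2_eq_square fps_mult_nth
    by (rule sum_bit_symmetric) (simp add: mult.commute)
  moreover have "n - n div 2 = n div 2" if "even n" using that by auto
  moreover have "x * x = x" for x :: bit by (cases x) simp_all
  ultimately show ?thesis by simp
qed

lemma fps_bit_power4_nth: "(g ^ 4) $ n = (if 4 dvd n then g $ (n div 4) else 0)" for g :: "bit fps"
proof -
  have "(g ^ 4) $ n = ((g\<^sup>2)\<^sup>2) $ n" by (simp flip: power_mult)
  moreover have "4 dvd n \<longleftrightarrow> even n \<and> even (n div 2)" by presburger
  moreover have "n div 2 div 2 = n div 4" by presburger
  ultimately show ?thesis unfolding fps_bit_square_nth by simp
qed

text \<open>The class 2 modulo 4 is that of
  \<open>104 * n + 6 = 4 * (26 * n + 1) + 2\<close>.\<close>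

definition section4 :: "bit fps \<Rightarrow> bit fps" where
  "section4 h = Abs_fps (\<lambda>k. h $ (4 * k + 2))"

text \<open>Modulo 2, \<open>g ^ 4\<close> is \<open>g\<close> with \<open>q\<close> replaced by
  \<open>q^4\<close>, so it moves indices only by multiples of 4.\<close>

lemma section4_power4_mult: "section4 (g ^ 4 * h) = g * section4 h"
proof (rule fps_ext)
  fix k
  have "section4 (g ^ 4 * h) $ k = (\<Sum>i=0..4 * k + 2. g ^ 4 $ i * h $ (4 * k + 2 - i))"
    by (simp add: section4_def fps_mult_nth)
  also have "\<dots> = (\<Sum>i\<in>(*) 4 ` {0..k}. g ^ 4 $ i * h $ (4 * k + 2 - i))"
  proof (rule sum.mono_neutral_right)
    show "\<forall>i\<in>{0..4 * k + 2} - (*) 4 ` {0..k}. g ^ 4 $ i * h $ (4 * k + 2 - i) = 0"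
    proof
      fix i assume i: "i \<in> {0..4 * k + 2} - (*) 4 ` {0..k}"
      have "\<not> 4 dvd i"
      proof
        assume "4 dvd i"
        then obtain c where "i = 4 * c" by blast
        then show False using i by auto
      qed
      then show "g ^ 4 $ i * h $ (4 * k + 2 - i) = 0" by (simp add: fps_bit_power4_nth)
    qed
  qed auto
  also have "\<dots> = (\<Sum>j=0..k. g $ j * h $ (4 * (k - j) + 2))"
  proof -
    have "4 * k + 2 - 4 * j = 4 * (k - j) + 2" if "j \<le> k" for j using that by auto
    then show ?thesis
      by (subst sum.reindex) (auto simp: inj_on_def fps_bit_power4_nth intro!: sum.cong)
  qed
  also have "\<dots> = (g * section4 h) $ k"
    by (simp add: section4_def fps_mult_nth)
  finally show "section4 (g ^ 4 * h) $ k = (g * section4 h) $ k" .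
qed

section \<open>Generating functions of weighted sets\<close>

definition count_gf :: "'a set \<Rightarrow> ('a \<Rightarrow> nat) \<Rightarrow> bit fps" where
  "count_gf S e = Abs_fps (\<lambda>n. of_nat (card {x \<in> S. e x = n}))"

lemma theta_conv_count_gf: "theta u v = count_gf UNIV (theta_exp u v)"
  by (simp add: theta_def count_gf_def)

lemma finite_theta_exp:
  assumes "0 < u" "0 < v"
  shows "finite {k. theta_exp u v k = n}"
proof (rule finite_subset)
  show "{k. theta_exp u v k = n} \<subseteq> {- int n..int n}"
  proof
    fix k assume "k \<in> {k. theta_exp u v k = n}"
    then show "k \<in> {- int n..int n}" using abs_le_theta_exp[OF assms, of k] by auto
  qed
qed simp

lemma finite_add_fibre:
  fixes e :: "'a \<Rightarrow> nat" and e' :: "'b \<Rightarrow> nat"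
  assumes "\<And>n. finite {x \<in> S. e x = n}" "\<And>n. finite {y \<in> S'. e' y = n}"
  shows "finite {z \<in> S \<times> S'. (case z of (x, y) \<Rightarrow> e x + e' y) = n}"
proof (rule finite_subset)
  show "{z \<in> S \<times> S'. (case z of (x, y) \<Rightarrow> e x + e' y) = n}
      \<subseteq> (\<Union>i\<in>{0..n}. {x \<in> S. e x = i} \<times> {y \<in> S'. e' y = n - i})"
    by auto
qed (use assms in auto)

lemma count_gf_mult:
  fixes e :: "'a \<Rightarrow> nat" and e' :: "'b \<Rightarrow> nat"
  assumes "\<And>n. finite {x \<in> S. e x = n}" "\<And>n. finite {y \<in> S'. e' y = n}"
  shows "count_gf S e * count_gf S' e' = count_gf (S \<times> S') (\<lambda>(x, y). e x + e' y)"
proof (rule fps_ext)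
  fix n
  have eq: "{z \<in> S \<times> S'. (case z of (x, y) \<Rightarrow> e x + e' y) = n}
      = (\<Union>i\<in>{0..n}. {x \<in> S. e x = i} \<times> {y \<in> S'. e' y = n - i})"
    by auto
  have "card {z \<in> S \<times> S'. (case z of (x, y) \<Rightarrow> e x + e' y) = n}
      = (\<Sum>i=0..n. card ({x \<in> S. e x = i} \<times> {y \<in> S'. e' y = n - i}))"
    unfolding eq using assms by (intro card_UN_disjoint) auto
  then show "(count_gf S e * count_gf S' e') $ n = count_gf (S \<times> S') (\<lambda>(x, y). e x + e' y) $ n"
    by (simp add: count_gf_def fps_mult_nth card_cartesian_product)
qed

text \<open>Finiteness is carried through the induction because the product rule needs it for the
  smaller index set.\<close>

lemma finite_PiE_fibre_and_prod_count_gf: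
  fixes e :: "'i \<Rightarrow> 'a \<Rightarrow> nat"
  assumes "finite I" "\<And>i n. i \<in> I \<Longrightarrow> finite {x. e i x = n}"
  shows "(\<forall>n. finite {g \<in> PiE I (\<lambda>_. UNIV). (\<Sum>i\<in>I. e i (g i)) = n}) \<and>
    (\<Prod>i\<in>I. count_gf UNIV (e i)) = count_gf (PiE I (\<lambda>_. UNIV)) (\<lambda>g. \<Sum>i\<in>I. e i (g i))"
  using assms
proof (induction I rule: finite_induct)
  case empty
  show ?case by (simp add: count_gf_def fps_eq_iff)
next
  case (insert x I)
  let ?P = "\<lambda>I. PiE I (\<lambda>_. UNIV :: 'a set)" and ?e = "\<lambda>I g. \<Sum>i\<in>I. e i (g i)"
  let ?h = "\<lambda>(y, g). g(x := y)" and ?e' = "\<lambda>(y, g). e x y + ?e I g"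
  have fin: "finite {g \<in> ?P I. ?e I g = n}" for n
    using insert by blast
  have inj: "inj_on ?h (UNIV \<times> ?P I)"
    using inj_combinator[OF insert.hyps(2), of "\<lambda>_. UNIV"] by (simp add: case_prod_beta')
  have e: "?e (insert x I) (?h z) = ?e' z" for z
    using insert.hyps by (auto simp: case_prod_beta' intro!: sum.cong)
  have eq: "{g \<in> ?P (insert x I). ?e (insert x I) g = n} = ?h ` {z \<in> UNIV \<times> ?P I. ?e' z = n}" for n
    unfolding PiE_insert_eq using e by auto
  have fin': "finite {z \<in> UNIV \<times> ?P I. ?e' z = n}" for n
    using insert.prems fin by (intro finite_add_fibre) auto
  have "card {g \<in> ?P (insert x I). ?e (insert x I) g = n} = card {z \<in> UNIV \<times> ?P I. ?e' z = n}" for n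
    unfolding eq by (intro card_image inj_on_subset[OF inj]) auto
  then have "count_gf (?P (insert x I)) (?e (insert x I)) = count_gf (UNIV \<times> ?P I) ?e'"
    by (simp only: count_gf_def)
  also have "\<dots> = count_gf UNIV (e x) * count_gf (?P I) (?e I)"
    using insert.prems fin by (intro count_gf_mult[symmetric]) auto
  finally have gf: "count_gf (?P (insert x I)) (?e (insert x I)) = count_gf UNIV (e x) * count_gf (?P I) (?e I)" .
  have "finite {g \<in> ?P (insert x I). ?e (insert x I) g = n}" for n
    unfolding eq using fin' by (rule finite_imageI)
  moreover have "(\<Prod>i\<in>insert x I. count_gf UNIV (e i)) = count_gf (?P (insert x I)) (?e (insert x I))"
    unfolding gf using insert by simp
  ultimately show ?case by blast
qed

lemma theta_exp_mult_nth:
  assumes "0 < u" "0 < v" "0 < u'" "0 < v'"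
  shows "(theta u v * theta u' v') $ n = of_nat (card {(k, l). theta_exp u v k + theta_exp u' v' l = n})"
  unfolding theta_conv_count_gf
  using assms by (subst count_gf_mult) (auto simp: finite_theta_exp count_gf_def case_prod_beta')

lemma prod_theta_nth:
  assumes "finite I" "\<And>i. i \<in> I \<Longrightarrow> 0 < u i \<and> 0 < v i"
  shows "(\<Prod>i\<in>I. theta (u i) (v i)) $ n =
    of_nat (card {g \<in> PiE I (\<lambda>_. UNIV). (\<Sum>i\<in>I. theta_exp (u i) (v i) (g i)) = n})"
  using finite_PiE_fibre_and_prod_count_gf[of I "\<lambda>i. theta_exp (u i) (v i)"] assms
  by (simp add: theta_conv_count_gf finite_theta_exp) (simp add: count_gf_def)

section \<open>Representations by two binary quadratic forms\<close>

definition forms_3_13 :: "int \<Rightarrow> (int \<times> int) set" where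
  "forms_3_13 M = {(x, y). x mod 4 = 1 \<and> y mod 6 = 1 \<and> 3 * x\<^sup>2 + 13 * y\<^sup>2 = M}"

definition forms_39_1 :: "int \<Rightarrow> (int \<times> int) set" where
  "forms_39_1 M = {(a, b). a mod 4 = 1 \<and> b mod 6 = 1 \<and> 39 * a\<^sup>2 + b\<^sup>2 = M}"

text \<open>Picks the one of \<open>x\<close> and \<open>- x\<close> in the class \<open>c\<close>
  modulo \<open>m\<close>, when there is one; the congruences on representations fix signs in this
  way.\<close>

definition sign_mod :: "int \<Rightarrow> int \<Rightarrow> int \<Rightarrow> int" where
  "sign_mod m c x = (if x mod m = c then x else - x)"

lemma sign_mod_cases: "sign_mod m c x = x \<or> sign_mod m c x = - x"
  by (simp add: sign_mod_def)

lemma sign_mod_square [simp]: "(sign_mod m c x)\<^sup>2 = x\<^sup>2"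
  by (simp add: sign_mod_def)

lemma sign_mod_4_1: "odd x \<Longrightarrow> sign_mod 4 1 x mod 4 = 1"
  unfolding sign_mod_def by (auto, presburger)

lemma sign_mod_4_3: "odd x \<Longrightarrow> sign_mod 4 3 x mod 4 = 3"
  unfolding sign_mod_def by (auto, presburger)

lemma sign_mod_6_1: "odd x \<Longrightarrow> \<not> 3 dvd x \<Longrightarrow> sign_mod 6 1 x mod 6 = 1"
  unfolding sign_mod_def by (auto, presburger)

lemma sign_mod_unique:
  assumes "x mod m = c" "y mod m = c" "x = y \<or> x = - y" "(2 * c) mod m \<noteq> (0::int)"
  shows "x = y"
proof (rule ccontr)
  assume "x \<noteq> y"
  then have "x + y = 0" using assms(3) by auto
  then have "(x mod m + y mod m) mod m = 0" by (simp add: mod_add_eq)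
  then show False using assms by simp
qed

text \<open>The change of variables \<open>x = (b - 13 a) / 2\<close>, \<open>y = (b + 3 a) / 2\<close> has
  \<open>3 x\<^sup>2 + 13 y\<^sup>2 = 4 (39 a\<^sup>2 + b\<^sup>2)\<close>; the sign of \<open>b\<close> relative to \<open>a\<close> is fixed by
  requiring \<open>x\<close> and \<open>y\<close> to be odd.\<close>
definition form_map :: "int \<times> int \<Rightarrow> int \<times> int" where
  "form_map = (\<lambda>(a, b). (sign_mod 4 1 ((sign_mod 4 3 b - 13 * a) div 2),
                          sign_mod 6 1 ((sign_mod 4 3 b + 3 * a) div 2)))"

lemma form_map_in:
  assumes "ab \<in> forms_39_1 M"
  shows "form_map ab \<in> forms_3_13 (4 * M)"
proof -
  obtain a b where ab: "ab = (a, b)" "a mod 4 = 1" "b mod 6 = 1" "39 * a\<^sup>2 + b\<^sup>2 = M"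
    using assms by (auto simp: forms_39_1_def)
  define c where "c = sign_mod 4 3 b"
  have "odd b" using ab(3) by presburger
  then have c4: "c mod 4 = 3" unfolding c_def by (rule sign_mod_4_3)
  have c3: "\<not> 3 dvd c"
  proof -
    have "\<not> 3 dvd b" using ab(3) by presburger
    then show ?thesis unfolding c_def sign_mod_def by auto
  qed
  \<comment> \<open>As \<open>c\<close> is 3 and \<open>a\<close> is 1 modulo 4, both numerators are
    2 modulo 4, so their halves are odd.\<close>
  define x y where "x = (c - 13 * a) div 2" and "y = (c + 3 * a) div 2"
  have x: "2 * x = c - 13 * a" "odd x" unfolding x_def using c4 ab(2) by presburger+
  have y: "2 * y = c + 3 * a" "odd y" unfolding y_def using c4 ab(2) by presburger+
  have y3: "\<not> 3 dvd y" using y(1) c3 by presburger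
  have "4 * (3 * x\<^sup>2 + 13 * y\<^sup>2) = 3 * (2 * x)\<^sup>2 + 13 * (2 * y)\<^sup>2"
    by (simp add: power2_eq_square)
  also have "\<dots> = 4 * (4 * (39 * a\<^sup>2 + c\<^sup>2))"
    unfolding x y by (simp add: power2_eq_square algebra_simps)
  finally have "3 * x\<^sup>2 + 13 * y\<^sup>2 = 4 * M" using ab(4) by (simp add: c_def)
  then show ?thesis
    using sign_mod_4_1[OF x(2)] sign_mod_6_1[OF y(2) y3]
    by (simp add: ab(1) form_map_def forms_3_13_def flip: c_def x_def y_def)
qed

text \<open>Equal images have \<open>x\<close> and \<open>y\<close> equal up to signs. If the two
  signs agree, \<open>(a, c)\<close> is determined up to a common sign, which
  \<open>a mod 4 = 1\<close> fixes; if they differ, a congruence modulo 4 fails.\<close>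

lemma form_map_inj: "inj_on form_map (forms_39_1 M)"
proof (rule inj_onI, clarify)
  fix a b a' b'
  assume mem: "(a, b) \<in> forms_39_1 M" "(a', b') \<in> forms_39_1 M"
    and eq: "form_map (a, b) = form_map (a', b')"
  have h: "a mod 4 = 1" "b mod 6 = 1" "a' mod 4 = 1" "b' mod 6 = 1"
    using mem by (auto simp: forms_39_1_def)
  define c c' where "c = sign_mod 4 3 b" and "c' = sign_mod 4 3 b'"
  have "odd b" "odd b'" using h by presburger+
  then have c4: "c mod 4 = 3" "c' mod 4 = 3" unfolding c_def c'_def by (simp_all add: sign_mod_4_3)
  define x y x' y' where "x = (c - 13 * a) div 2" and "y = (c + 3 * a) div 2"
    and "x' = (c' - 13 * a') div 2" and "y' = (c' + 3 * a') div 2"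
  have xy: "2 * x = c - 13 * a" "2 * y = c + 3 * a" "2 * x' = c' - 13 * a'" "2 * y' = c' + 3 * a'"
    unfolding x_def y_def x'_def y'_def using c4 h by presburger+
  have "sign_mod 4 1 x = sign_mod 4 1 x'" "sign_mod 6 1 y = sign_mod 6 1 y'"
    using eq by (simp_all add: form_map_def c_def c'_def x_def y_def x'_def y'_def)
  then have "x = x' \<or> x = - x'" "y = y' \<or> y = - y'"
    using sign_mod_cases[of 4 1] sign_mod_cases[of 6 1] by (metis minus_equation_iff)+
  \<comment> \<open>One has \<open>2 * y - 2 * x = 16 * a\<close>; if exactly one sign differs, this
    is also \<open>2 * x' + 2 * y' = 2 * c' - 10 * a'\<close> up to sign.\<close>
  moreover have no: "8 * z \<noteq> c' - 5 * a'" for z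
  proof -
    have "(c' - 5 * a') mod 4 = 2" using c4(2) h(3) by presburger
    then show ?thesis by presburger
  qed
  ultimately consider "x = x'" "y = y'" | "x = - x'" "y = - y'" | "x = - x'" "y = y'" | "x = x'" "y = - y'"
    by blast
  then have ac: "a = a' \<and> c = c'"
  proof cases
    case 1
    then show ?thesis using xy by linarith
  next
    case 2
    then have "a = - a'" using xy by linarith
    then show ?thesis using h(1,3) by presburger
  next
    case 3
    then have "8 * a = c' - 5 * a'" using xy by linarith
    then show ?thesis using no by simp
  next
    case 4
    then have "8 * (- a) = c' - 5 * a'" using xy by linarith
    then show ?thesis using no by blast
  qed
  then have "b = b' \<or> b = - b'"
    unfolding c_def c'_def using sign_mod_cases[of 4 3] by (metis minus_equation_iff)
  then show "a = a' \<and> b = b'" using ac h sign_mod_unique[of b 6 1 b'] by simp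
qed

text \<open>The inverse substitution is \<open>a = (y - x) / 8\<close>,
  \<open>c = (3 * x + 13 * y) / 8\<close>. For odd \<open>y\<close> it yields integers with
  \<open>a\<close> odd exactly when \<open>x\<close> is \<open>9 * y\<close> modulo 16, and the
  condition on \<open>M\<close> ensures this for \<open>x\<close> or \<open>- x\<close>.\<close>

lemma form_map_surj:
  assumes "xy \<in> forms_3_13 (4 * M)" "M mod 24 = 16"
  shows "xy \<in> form_map ` forms_39_1 M"
proof -
  obtain x y where xy: "xy = (x, y)" "x mod 4 = 1" "y mod 6 = 1" "3 * x\<^sup>2 + 13 * y\<^sup>2 = 4 * M"
    using assms by (auto simp: forms_3_13_def)
  have ox: "odd x" and oy: "odd y" and y3: "\<not> 3 dvd y" using xy by presburger+
  \<comment> \<open>Since \<open>3 * 81 + 13 = 256\<close> and 8 divides \<open>M\<close>, the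
    product \<open>p * q\<close> is divisible by 8.\<close>
  define p q where "p = (x - 9 * y) div 2" and "q = (x + 9 * y) div 2"
  have pq: "2 * p = x - 9 * y" "2 * q = x + 9 * y"
    unfolding p_def q_def using ox oy by presburger+
  have "12 * (p * q) = 3 * ((2 * p) * (2 * q))" by simp
  also have "\<dots> = (3 * x\<^sup>2 + 13 * y\<^sup>2) - 256 * y\<^sup>2"
    unfolding pq by (simp add: power2_eq_square algebra_simps)
  finally have "12 * (p * q) = 4 * M - 256 * y\<^sup>2" using xy by simp
  then have "3 * (p * q) = M - 8 * (8 * y\<^sup>2)" by linarith
  moreover have "8 dvd M" using assms(2) by presburger
  ultimately have "8 dvd 3 * (p * q)" by (simp only: dvd_diff dvd_triv_left)
  moreover have "8 dvd z" if "8 dvd 3 * z" for z :: int using that by presburger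
  ultimately have "8 dvd p * q" by blast
  \<comment> \<open>As \<open>q - p = 9 * y\<close> is odd, one of the two is odd and the other
    takes the whole factor 8.\<close>
  moreover have "odd p \<or> odd q" using pq oy by presburger
  ultimately have "8 dvd p \<or> 8 dvd q"
  proof (elim disjE)
    assume "odd p"
    then have "coprime 8 p" using coprime_power_left_iff[of 2 3 p] by simp
    then show ?thesis using \<open>8 dvd p * q\<close> coprime_dvd_mult_right_iff by blast
  next
    assume "odd q"
    then have "coprime 8 q" using coprime_power_left_iff[of 2 3 q] by simp
    then show ?thesis using \<open>8 dvd p * q\<close> coprime_dvd_mult_left_iff by blast
  qed
  then obtain x' t where t: "x' = x \<or> x' = - x" "x' = 9 * y + 16 * t"
  proof
    assume "8 dvd p"
    then obtain s where "p = 8 * s" by blast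
    then have "x = 9 * y + 16 * s" using pq(1) by linarith
    then show ?thesis using that[of x s] by blast
  next
    assume "8 dvd q"
    then obtain s where "q = 8 * s" by blast
    then have "- x = 9 * y + 16 * (- s)" using pq(2) by linarith
    then show ?thesis using that[of "- x" "- s"] by blast
  qed
  \<comment> \<open>The values of \<open>(y - x') / 8\<close> and
    \<open>(3 * x' + 13 * y) / 8\<close> at \<open>x' = 9 * y + 16 * t\<close>.\<close>
  define a0 c0 where "a0 = - y - 2 * t" and "c0 = 5 * y + 6 * t"
  have "odd a0" unfolding a0_def using oy by simp
  \<comment> \<open>The common sign \<open>e\<close> moves \<open>a\<close> into the class 1 modulo
    4; it only changes the signs of \<open>x'\<close> and \<open>y\<close>, which
    \<open>sign_mod\<close> restores.\<close>
  obtain a c e where e: "e = 1 \<or> e = - 1" "a = e * a0" "c = e * c0" "a mod 4 = 1"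
  proof (cases "a0 mod 4 = 1")
    case True
    then show ?thesis using that[of 1 a0 c0] by simp
  next
    case False
    then have "(- a0) mod 4 = 1" using \<open>odd a0\<close> by presburger
    then show ?thesis using that[of "-1" "- a0" "- c0"] by simp
  qed
  have lin: "c - 13 * a = 2 * (e * x')" "c + 3 * a = 2 * (e * y)"
    unfolding e(2,3) a0_def c0_def t(2) by (simp_all add: algebra_simps)
  have sq: "(e * x')\<^sup>2 = x\<^sup>2" "(e * y)\<^sup>2 = y\<^sup>2" using e(1) t(1) by auto
  have "4 * (4 * (39 * a\<^sup>2 + c\<^sup>2)) = 3 * (c - 13 * a)\<^sup>2 + 13 * (c + 3 * a)\<^sup>2"
    by (simp add: power2_eq_square algebra_simps)
  also have "\<dots> = 4 * (3 * x\<^sup>2 + 13 * y\<^sup>2)"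
    unfolding lin using sq by (simp add: power_mult_distrib)
  finally have M: "39 * a\<^sup>2 + c\<^sup>2 = M" using xy(4) by simp
  have oey: "odd (e * y)" using e(1) oy by auto
  have "c mod 4 = 3" if "c + 3 * a = 2 * z" "odd z" for z
    using that e(4) by presburger
  then have c4: "c mod 4 = 3" using lin(2) oey by blast
  have "\<not> 3 dvd e * y" using e(1) y3 by auto
  moreover have "\<not> 3 dvd c" if "c + 3 * a = 2 * z" "\<not> 3 dvd z" for z
    using that by presburger
  ultimately have c3: "\<not> 3 dvd c" using lin(2) by blast
  define b where "b = sign_mod 6 1 c"
  have b6: "b mod 6 = 1" unfolding b_def using c3 c4 by (intro sign_mod_6_1) presburger+
  have "b = c \<or> b = - c" unfolding b_def by (rule sign_mod_cases)
  then have bc: "sign_mod 4 3 b = c" using c4 unfolding sign_mod_def by auto presburger+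
  have "(a, b) \<in> forms_39_1 M"
    using M b6 e(4) by (simp add: forms_39_1_def b_def)
  moreover have "form_map (a, b) = (x, y)"
  proof -
    have "sign_mod 4 1 (e * x') = x"
    proof (rule sign_mod_unique[of _ 4 1])
      show "sign_mod 4 1 (e * x') mod 4 = 1" using e(1) t(1) ox by (intro sign_mod_4_1) auto
      show "sign_mod 4 1 (e * x') = x \<or> sign_mod 4 1 (e * x') = - x"
        using sign_mod_cases[of 4 1 "e * x'"] e(1) t(1) by auto
    qed (use xy in auto)
    moreover have "sign_mod 6 1 (e * y) = y"
    proof (rule sign_mod_unique[of _ 6 1])
      show "sign_mod 6 1 (e * y) mod 6 = 1" using e(1) y3 oy by (intro sign_mod_6_1) auto
      show "sign_mod 6 1 (e * y) = y \<or> sign_mod 6 1 (e * y) = - y"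
        using sign_mod_cases[of 6 1 "e * y"] e(1) by auto
    qed (use xy in auto)
    ultimately show ?thesis by (simp add: form_map_def bc lin)
  qed
  ultimately show ?thesis using xy(1) by (metis image_eqI)
qed

lemma card_forms:
  assumes "M mod 24 = 16"
  shows "card (forms_3_13 (4 * M)) = card (forms_39_1 M)"
proof -
  have "bij_betw form_map (forms_39_1 M) (forms_3_13 (4 * M))"
    using form_map_inj form_map_in form_map_surj[OF _ assms] by (auto simp: bij_betw_def)
  then show ?thesis by (simp add: bij_betw_same_card)
qed

lemma card_affine_int_pairs:
  assumes "\<And>k l. P k l \<longleftrightarrow> Q (4 * k + 1) (6 * l + 1)"
  shows "card {(k::int, l::int). P k l} = card {(x, y). x mod 4 = 1 \<and> y mod 6 = 1 \<and> Q x y}"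
proof (rule bij_betw_same_card)
  show "bij_betw (\<lambda>(k, l). (4 * k + 1, 6 * l + 1)) {(k, l). P k l} {(x, y). x mod 4 = 1 \<and> y mod 6 = 1 \<and> Q x y}"
  proof (rule bij_betw_byWitness[where f' = "\<lambda>(x, y). (x div 4, y div 6)"])
    have "4 * (x div 4) + 1 = x" if "x mod 4 = 1" for x :: int using that by presburger
    moreover have "6 * (y div 6) + 1 = y" if "y mod 6 = 1" for y :: int using that by presburger
    ultimately show "\<forall>z\<in>{(x, y). x mod 4 = 1 \<and> y mod 6 = 1 \<and> Q x y}.
        (case case z of (x, y) \<Rightarrow> (x div 4, y div 6) of (k, l) \<Rightarrow> (4 * k + 1, 6 * l + 1)) = z"
      and "(\<lambda>(x, y). (x div 4, y div 6)) ` {(x, y). x mod 4 = 1 \<and> y mod 6 = 1 \<and> Q x y} \<subseteq> {(k, l). P k l}"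
      by (auto simp: assms)
    have "(4 * k + 1) div 4 = k" "(6 * k + 1) div 6 = k" "(4 * k + 1) mod 4 = 1" "(6 * k + 1) mod 6 = 1" for k :: int
      by presburger+
    then show "\<forall>z\<in>{(k, l). P k l}.
        (case case z of (k, l) \<Rightarrow> (4 * k + 1, 6 * l + 1) of (x, y) \<Rightarrow> (x div 4, y div 6)) = z"
      and "(\<lambda>(k, l). (4 * k + 1, 6 * l + 1)) ` {(k, l). P k l} \<subseteq> {(x, y). x mod 4 = 1 \<and> y mod 6 = 1 \<and> Q x y}"
      by (auto simp flip: assms)
  qed
qed

text \<open>Completing squares: \<open>24 * theta_exp 3 1 k + 3 = 3 * (4 * k + 1)^2\<close> and
  \<open>24 * theta_exp 26 13 l + 13 = 13 * (6 * l + 1)^2\<close>.\<close>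

lemma card_theta_exp_3_1_26_13:
  "card {(k, l). theta_exp 3 1 k + theta_exp 26 13 l = 4 * n + 2} = card (forms_3_13 (4 * (24 * int n + 16)))"
  unfolding forms_3_13_def
proof (rule card_affine_int_pairs)
  fix k l :: int
  have "theta_exp 3 1 k + theta_exp 26 13 l = 4 * n + 2
     \<longleftrightarrow> 2 * int (theta_exp 3 1 k) + 2 * int (theta_exp 26 13 l) = 8 * int n + 4"
    by linarith
  also have "\<dots> \<longleftrightarrow> 3 * (4 * k + 1)\<^sup>2 + 13 * (6 * l + 1)\<^sup>2 = 4 * (24 * int n + 16)"
    unfolding two_theta_exp by (simp add: power2_eq_square algebra_simps) linarith
  finally show "theta_exp 3 1 k + theta_exp 26 13 l = 4 * n + 2
     \<longleftrightarrow> 3 * (4 * k + 1)\<^sup>2 + 13 * (6 * l + 1)\<^sup>2 = 4 * (24 * int n + 16)" .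
qed

text \<open>Here \<open>24 * theta_exp 39 13 k + 39 = 39 * (4 * k + 1)^2\<close> and
  \<open>24 * theta_exp 2 1 l + 1 = (6 * l + 1)^2\<close>; the summand 1 on the left stands for a
  factor \<open>q\<close>.\<close>

lemma card_theta_exp_39_13_2_1:
  "card {(k, l). theta_exp 39 13 k + theta_exp 2 1 l + 1 = n} = card (forms_39_1 (24 * int n + 16))"
  unfolding forms_39_1_def
proof (rule card_affine_int_pairs)
  fix k l :: int
  have "theta_exp 39 13 k + theta_exp 2 1 l + 1 = n
     \<longleftrightarrow> 2 * int (theta_exp 39 13 k) + 2 * int (theta_exp 2 1 l) + 2 = 2 * int n"
    by linarith
  also have "\<dots> \<longleftrightarrow> 39 * (4 * k + 1)\<^sup>2 + (6 * l + 1)\<^sup>2 = 24 * int n + 16"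
    unfolding two_theta_exp by (simp add: power2_eq_square algebra_simps) linarith
  finally show "theta_exp 39 13 k + theta_exp 2 1 l + 1 = n
     \<longleftrightarrow> 39 * (4 * k + 1)\<^sup>2 + (6 * l + 1)\<^sup>2 = 24 * int n + 16" .
qed

text \<open>Both sides are products of two theta series, whose coefficients count representations of
  \<open>4 * M\<close> and of \<open>M = 24 * n + 16\<close>; \<open>card_forms\<close> equates the
  counts.\<close>

lemma section4_euler_cube:
  "section4 (euler 1 ^ 3 * euler 13) = fps_X * (euler 13 ^ 3 * euler 1)"
proof (rule fps_ext)
  fix n
  have "section4 (euler 1 ^ 3 * euler 13) $ n = (theta 3 1 * theta 26 13) $ (4 * n + 2)"
    using euler_cube_eq_theta[of 1] euler_eq_theta[of 13] by (simp add: section4_def)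
  also have "\<dots> = of_nat (card (forms_3_13 (4 * (24 * int n + 16))))"
    by (simp only: theta_exp_mult_nth card_theta_exp_3_1_26_13 zero_less_numeral zero_less_one)
  also have "\<dots> = of_nat (card {(k, l). theta_exp 39 13 k + theta_exp 2 1 l + 1 = n})"
    unfolding card_theta_exp_39_13_2_1 by (subst card_forms) simp_all
  also have "\<dots> = (fps_X * (theta 39 13 * theta 2 1)) $ n"
  proof (cases n)
    case 0
    then show ?thesis by (simp add: case_prod_beta')
  next
    case (Suc m)
    then show ?thesis by (simp add: theta_exp_mult_nth)
  qed
  also have "theta 39 13 * theta 2 1 = euler 13 ^ 3 * euler 1"
    using euler_cube_eq_theta[of 13] euler_eq_theta[of 1] by simp
  finally show "section4 (euler 1 ^ 3 * euler 13) $ n = (fps_X * (euler 13 ^ 3 * euler 1)) $ n" .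
qed

lemma section4_prod_theta_13:
  "section4 (\<Prod>i\<in>{1..6}. theta (13 + 2 * i) (13 - 2 * i)) = fps_X * euler 13 ^ 6"
proof -
  let ?G = "\<Prod>i\<in>{1..6::nat}. theta (13 + 2 * i) (13 - 2 * i)"
  have "euler 1 ^ 2 * section4 ?G = section4 ((euler 1 ^ 2) ^ 4 * ?G)"
    by (simp only: section4_power4_mult)
  also have "(euler 1 ^ 2) ^ 4 * ?G = euler 1 ^ 7 * (?G * euler 1)"
    by (simp flip: power_mult power_Suc2 add: mult_ac power_Suc[symmetric] mult.assoc[symmetric])
  also have "\<dots> = (euler 13 ^ 3 * euler 1) ^ 4 * (euler 1 ^ 3 * euler 13)"
    unfolding prod_theta_13
    by (simp add: power_mult_distrib numeral_eq_Suc mult_ac)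
  also have "section4 \<dots> = euler 1 ^ 2 * (fps_X * euler 13 ^ 6)"
    unfolding section4_power4_mult section4_euler_cube
    by (simp add: numeral_eq_Suc mult_ac)
  finally show ?thesis by (simp only: mult_cancel_left power_eq_0_iff euler_nonzero) simp
qed

text \<open>The factor \<open>q\<close> removes the 1 of \<open>26 * n + 1\<close>, squaring modulo
  2 halves \<open>26 * n\<close>, and \<open>(euler 13)^3\<close> is \<open>(euler 1)^3\<close> in
  \<open>q^13\<close>.\<close>

lemma prod_theta_13_nth:
  "(\<Prod>i\<in>{1..6}. theta (13 + 2 * i) (13 - 2 * i)) $ (104 * n + 6) = theta 3 1 $ n"
proof -
  let ?G = "\<Prod>i\<in>{1..6::nat}. theta (13 + 2 * i) (13 - 2 * i)"
  have "?G $ (104 * n + 6) = section4 ?G $ Suc (26 * n)"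
    by (simp add: section4_def add.commute)
  also have "\<dots> = euler 13 ^ 6 $ (26 * n)"
    unfolding section4_prod_theta_13 by simp
  also have "euler 13 ^ 6 = (euler 13 ^ 3)\<^sup>2" by (simp flip: power_mult)
  also have "euler 13 ^ 3 = theta 39 13" using euler_cube_eq_theta[of 13] by simp
  also have "(theta 39 13)\<^sup>2 $ (26 * n) = theta 39 13 $ (13 * n)"
    by (simp add: fps_bit_square_nth)
  also have "\<dots> = theta 3 1 $ n"
  proof -
    have "2 * int (theta_exp 39 13 k) = 2 * int (13 * theta_exp 3 1 k)" for k
      unfolding of_nat_mult using two_theta_exp[of 39 13 k] two_theta_exp[of 3 1 k] by (simp add: algebra_simps)
    then have "theta_exp 39 13 k = 13 * theta_exp 3 1 k" for k
      by (metis mult_cancel_left of_nat_eq_iff zero_neq_numeral)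
    then show ?thesis by (simp add: theta_def)
  qed
  finally show ?thesis .
qed

section \<open>Core partitions and beta sets\<close>

text \<open>The first-column hook numbers \<open>lam_i + l - i\<close> of a partition with
  \<open>l\<close> parts.\<close>

primrec beta_set :: "nat list \<Rightarrow> nat set" where
  "beta_set [] = {}"
| "beta_set (x # lam) = insert (x + length lam) (beta_set lam)"

lemma finite_beta_set [simp]: "finite (beta_set lam)"
  by (induction lam) auto

lemma beta_set_less: "\<forall>y\<in>set lam. y \<le> x \<Longrightarrow> b \<in> beta_set lam \<Longrightarrow> b < x + length lam"
  by (induction lam) fastforce+

lemma zero_notin_beta_set: "\<forall>x\<in>set lam. 0 < x \<Longrightarrow> 0 \<notin> beta_set lam"
  by (induction lam) auto

lemma beta_set_Cons_notin: "sorted_wrt (\<ge>) (x # lam) \<Longrightarrow> x + length lam \<notin> beta_set lam"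
  using beta_set_less[of lam x] by fastforce

lemma card_beta_set: "sorted_wrt (\<ge>) lam \<Longrightarrow> card (beta_set lam) = length lam"
  by (induction lam) (auto simp: beta_set_Cons_notin simp del: sorted_wrt.simps(2) dest: sorted_wrt.simps(2)[THEN iffD1])

lemma sum_beta_set: "sorted_wrt (\<ge>) lam \<Longrightarrow> \<Sum>(beta_set lam) = sum_list lam + \<Sum>{..<length lam}"
  by (induction lam) (auto simp: beta_set_Cons_notin lessThan_Suc simp del: sorted_wrt.simps(2) dest: sorted_wrt.simps(2)[THEN iffD1])

text \<open>The rows and the columns of a diagram together label an initial interval without
  overlap. A new top row of length \<open>x\<close> has as hook numbers the differences between
  \<open>x + length lam\<close> and these gaps.\<close>

lemma beta_set_gaps:
  assumes "sorted_wrt (\<ge>) lam" "\<forall>y\<in>set lam. y \<le> x"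
  shows "(\<lambda>j. length lam + j - 1 - col_len lam j) ` {1..x} = {..<x + length lam} - beta_set lam"
  using assms
proof (induction lam arbitrary: x)
  case Nil
  have "(\<lambda>j. j - 1) ` {1..x} = {..<x}"
    by (simp only: image_Suc_lessThan[symmetric] image_image diff_Suc_1 image_ident)
  then show ?case by (simp add: col_len_def)
next
  case (Cons y lam)
  let ?g = "\<lambda>lam j. length lam + j - 1 - col_len lam j"
  have srt: "sorted_wrt (\<ge>) lam" "\<forall>z\<in>set lam. z \<le> y" and yx: "y \<le> x"
    using Cons.prems by auto
  \<comment> \<open>For \<open>j \<le> y\<close> the new row lengthens both the column and the list
    by one; beyond \<open>y\<close> the columns are empty and give an interval.\<close>
  have low: "?g (y # lam) j = ?g lam j" if "j \<le> y" for j
    using that by (simp add: col_len_def)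
  have high: "?g (y # lam) j = length lam + j" if "y < j" for j
  proof -
    have "filter (\<lambda>x. j \<le> x) (y # lam) = []"
      using that srt(2) by (auto simp: filter_empty_conv)
    then show ?thesis by (simp add: col_len_def)
  qed
  have "?g (y # lam) ` {1..x} = ?g (y # lam) ` {1..y} \<union> ?g (y # lam) ` {y<..x}"
    using yx by (auto simp flip: image_Un intro!: arg_cong[where f = "image _"])
  also have "?g (y # lam) ` {1..y} = ?g lam ` {1..y}"
    by (rule image_cong[OF refl]) (simp only: low atLeastAtMost_iff)
  also have "\<dots> = {..<y + length lam} - beta_set lam"
    by (rule Cons.IH[OF srt])
  also have "?g (y # lam) ` {y<..x} = (\<lambda>j. length lam + j) ` {y<..x}"
    by (rule image_cong[OF refl]) (simp only: high greaterThanAtMost_iff)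
  also have "\<dots> = {length lam + y<..length lam + x}"
    by auto
  also have "({..<y + length lam} - beta_set lam) \<union> {length lam + y<..length lam + x}
      = {..<x + length (y # lam)} - beta_set (y # lam)"
    using yx beta_set_less[OF srt(2)] by fastforce
  finally show ?case .
qed

lemma cells_Cons: "cells (x # lam) = {1} \<times> {1..x} \<union> (\<lambda>(i, j). (Suc i, j)) ` cells lam"
proof (rule Set.set_eqI)
  fix c :: "nat \<times> nat"
  obtain i j where c: "c = (i, j)" by force
  consider "i = 0" | "i = 1" | k where "i = Suc k" "k \<ge> 1"
    by (metis One_nat_def Suc_le_eq not0_implies_Suc gr0I)
  then show "c \<in> cells (x # lam) \<longleftrightarrow> c \<in> {1} \<times> {1..x} \<union> (\<lambda>(i, j). (Suc i, j)) ` cells lam"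
    by cases (auto simp: c cells_def row_len_def image_iff)
qed

text \<open>A row put on top leaves the hooks below unchanged, and \<open>beta_set_gaps\<close>
  describes the hooks of the new row.\<close>

lemma is_core_Cons:
  assumes "sorted_wrt (\<ge>) (x # lam)"
  shows "is_core t (x # lam) \<longleftrightarrow>
    is_core t lam \<and> (\<forall>z\<in>{..<x + length lam} - beta_set lam. \<not> t dvd x + length lam - z)"
proof -
  have lower: "hook (x # lam) (Suc i) j = hook lam i j" if "(i, j) \<in> cells lam" for i j
  proof -
    have i: "1 \<le> i" "i \<le> length lam" "j \<le> lam ! (i - 1)"
      using that by (auto simp: cells_def row_len_def)
    then have "lam ! (i - 1) \<in> set lam" by (intro nth_mem) simp
    then have "j \<le> x" using assms i(3) by fastforce
    then show ?thesis using i(1) by (simp add: hook_def row_len_def col_len_def nth_Cons')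
  qed
  have upper: "int t dvd hook (x # lam) 1 j \<longleftrightarrow> t dvd x + length lam - (length lam + j - 1 - col_len lam j)"
    if "j \<in> {1..x}" for j
  proof -
    have "col_len lam j \<le> length lam" by (simp add: col_len_def)
    then have "hook (x # lam) 1 j = int (x + length lam - (length lam + j - 1 - col_len lam j))"
      using that by (simp add: hook_def row_len_def) (simp add: col_len_def)
    then show ?thesis by simp
  qed
  have "is_core t (x # lam) \<longleftrightarrow> is_core t lam \<and> (\<forall>j\<in>{1..x}. \<not> int t dvd hook (x # lam) 1 j)"
  proof -
    let ?P = "\<lambda>(i, j). \<not> int t dvd hook (x # lam) i j"
    have "is_core t (x # lam) \<longleftrightarrow> (\<forall>c\<in>(\<lambda>(i, j). (Suc i, j)) ` cells lam. ?P c) \<and> (\<forall>c\<in>{1} \<times> {1..x}. ?P c)"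
      unfolding is_core_def cells_Cons ball_Un by (rule conj_commute)
    also have "(\<forall>c\<in>(\<lambda>(i, j). (Suc i, j)) ` cells lam. ?P c) \<longleftrightarrow> is_core t lam"
      unfolding is_core_def ball_simps(9) by (rule ball_cong) (auto simp: lower)
    also have "(\<forall>c\<in>{1} \<times> {1..x}. ?P c) \<longleftrightarrow> (\<forall>j\<in>{1..x}. \<not> int t dvd hook (x # lam) 1 j)"
      by auto
    finally show ?thesis .
  qed
  also have "(\<forall>j\<in>{1..x}. \<not> int t dvd hook (x # lam) 1 j) \<longleftrightarrow>
      (\<forall>z\<in>(\<lambda>j. length lam + j - 1 - col_len lam j) ` {1..x}. \<not> t dvd x + length lam - z)"
    using upper by simp
  also have "(\<lambda>j. length lam + j - 1 - col_len lam j) ` {1..x} = {..<x + length lam} - beta_set lam"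
    using assms by (intro beta_set_gaps) auto
  finally show ?thesis .
qed

text \<open>The hook numbers in the row of \<open>b\<close> are the \<open>b - z\<close> for the
  gaps \<open>z < b\<close>; rows added above bring only larger elements, so these gaps
  stay.\<close>

lemma is_core_iff_gaps:
  assumes "sorted_wrt (\<ge>) lam"
  shows "is_core t lam \<longleftrightarrow> (\<forall>b\<in>beta_set lam. \<forall>z\<in>{..<b} - beta_set lam. \<not> t dvd b - z)"
  using assms
proof (induction lam)
  case Nil
  then show ?case by (simp add: is_core_def cells_def)
next
  case (Cons x lam)
  have less: "b < x + length lam" if "b \<in> beta_set lam" for b
    using Cons.prems that by (intro beta_set_less) auto
  let ?R = "\<lambda>B b. \<forall>z\<in>{..<b} - B. \<not> t dvd b - z"
  have "{..<b} - beta_set (x # lam) = {..<b} - beta_set lam" if "b \<in> beta_set lam" for b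
    using less[OF that] by auto
  then have 1: "?R (beta_set (x # lam)) b \<longleftrightarrow> ?R (beta_set lam) b" if "b \<in> beta_set lam" for b
    using that by (simp only:)
  have "{..<x + length lam} - beta_set (x # lam) = {..<x + length lam} - beta_set lam" by auto
  then have 2: "?R (beta_set (x # lam)) (x + length lam) \<longleftrightarrow> ?R (beta_set lam) (x + length lam)"
    by (simp only:)
  have "sorted_wrt (\<ge>) lam" using Cons.prems by simp
  then have "is_core t (x # lam) \<longleftrightarrow> (\<forall>b\<in>beta_set lam. ?R (beta_set lam) b) \<and> ?R (beta_set lam) (x + length lam)"
    unfolding is_core_Cons[OF Cons.prems] using Cons.IH by (simp only:)
  also have "\<dots> \<longleftrightarrow> (\<forall>b\<in>insert (x + length lam) (beta_set lam). ?R (beta_set (x # lam)) b)"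
    unfolding ball_simps(7) 2 using 1 by blast
  finally show ?case by (simp only: beta_set.simps(2))
qed

text \<open>On the abacus with \<open>t\<close> runners every bead rests on another bead or on the
  bottom. Leaving out 0 means having no zero parts.\<close>

definition core_set :: "nat \<Rightarrow> nat set \<Rightarrow> bool" where
  "core_set t X \<longleftrightarrow> finite X \<and> 0 \<notin> X \<and> (\<forall>b\<in>X. t \<le> b \<longrightarrow> b - t \<in> X)"

lemma core_set_diff_multiple:
  assumes "core_set t X" "b \<in> X" "t * q \<le> b"
  shows "b - t * q \<in> X"
  using assms(3)
proof (induction q)
  case (Suc q)
  then have "b - t * q \<in> X" "t \<le> b - t * q" by auto
  then have "b - t * q - t \<in> X" using assms(1) by (auto simp: core_set_def)
  then show ?case by (simp add: algebra_simps)
qed (use assms in simp)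

lemma is_core_iff_core_set:
  assumes "sorted_wrt (\<ge>) lam" "\<forall>x\<in>set lam. 0 < x" "0 < t"
  shows "is_core t lam \<longleftrightarrow> core_set t (beta_set lam)"
proof
  assume "is_core t lam"
  then have *: "\<forall>b\<in>beta_set lam. \<forall>z\<in>{..<b} - beta_set lam. \<not> t dvd b - z"
    using is_core_iff_gaps[OF assms(1)] by blast
  have "b - t \<in> beta_set lam" if b: "b \<in> beta_set lam" "t \<le> b" for b
  proof (rule ccontr)
    assume "b - t \<notin> beta_set lam"
    then have "b - t \<in> {..<b} - beta_set lam" using b assms(3) by auto
    then have "\<not> t dvd b - (b - t)" using * b(1) by blast
    then show False using b(2) by simp
  qed
  then show "core_set t (beta_set lam)"
    using zero_notin_beta_set[OF assms(2)] by (auto simp: core_set_def)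
next
  assume core: "core_set t (beta_set lam)"
  have "\<not> t dvd b - z" if bz: "b \<in> beta_set lam" "z \<in> {..<b} - beta_set lam" for b z
  proof
    assume "t dvd b - z"
    then obtain q where q: "b - z = t * q" by blast
    then have "b - t * q = z" "t * q \<le> b" using bz by auto
    then show False using core_set_diff_multiple[OF core bz(1), of q] bz by auto
  qed
  then show "is_core t lam" using is_core_iff_gaps[OF assms(1)] by blast
qed

text \<open>The cardinality gives the number of parts, and the maximum then gives the first
  part.\<close>

lemma beta_set_inj:
  "sorted_wrt (\<ge>) lam \<Longrightarrow> sorted_wrt (\<ge>) mu \<Longrightarrow> beta_set lam = beta_set mu \<Longrightarrow> lam = mu"
proof (induction lam arbitrary: mu)
  case Nil
  then show ?case by (cases mu) auto
next
  case (Cons x lam)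
  then obtain y mu' where mu: "mu = y # mu'" by (cases mu) auto
  have max: "Max (beta_set (z # nu)) = z + length nu" if "sorted_wrt (\<ge>) (z # nu)" for z nu
    using that beta_set_less[of nu z] by (intro Max_eqI) (auto intro: less_imp_le)
  have "length (x # lam) = length mu"
    using Cons.prems card_beta_set by metis
  then have len: "length lam = length mu'" using mu by simp
  then have xy: "x = y" using max[of x lam] max[of y mu'] Cons.prems mu by simp
  have "beta_set lam = beta_set (x # lam) - {x + length lam}"
    using beta_set_Cons_notin[OF Cons.prems(1)] by auto
  also have "\<dots> = beta_set mu - {y + length mu'}" using Cons.prems(3) xy len by simp
  also have "\<dots> = beta_set mu'"
    using beta_set_Cons_notin[of y mu'] Cons.prems(2) mu by auto
  finally have "lam = mu'" using Cons.prems mu by (intro Cons.IH) auto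
  then show ?case using xy mu by simp
qed

lemma beta_set_surj:
  assumes "finite X" "0 \<notin> X"
  shows "\<exists>lam. sorted_wrt (\<ge>) lam \<and> (\<forall>x\<in>set lam. 0 < x) \<and> beta_set lam = X"
  using assms
proof (induction X rule: finite_linorder_max_induct)
  case empty
  show ?case by (rule exI[of _ "[]"]) simp
next
  case (insert b A)
  then obtain lam where lam: "sorted_wrt (\<ge>) lam" "\<forall>x\<in>set lam. 0 < x" "beta_set lam = A" by auto
  \<comment> \<open>The largest element \<open>b\<close> will become the first part
    \<open>b - length lam\<close>, which has to be positive and at least as large as the other
    parts.\<close>
  have gt: "length lam < b \<and> (\<forall>y\<in>set lam. y \<le> b - length lam)"
  proof (cases lam)
    case Nil
    then show ?thesis using insert.prems by simp
  next
    case (Cons x mu)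
    then have "x + length mu < b" using insert.hyps lam(3) by auto
    moreover have "0 < x" "\<forall>y\<in>set lam. y \<le> x" using Cons lam by auto
    ultimately show ?thesis using Cons by fastforce
  qed
  then have "sorted_wrt (\<ge>) ((b - length lam) # lam)" "\<forall>x\<in>set ((b - length lam) # lam). 0 < x"
    "beta_set ((b - length lam) # lam) = insert b A"
    using lam by auto
  then show ?case by blast
qed

lemma a_core_eq_card_core_sets:
  assumes "0 < t"
  shows "a_core t m = card {X. core_set t X \<and> \<Sum>X = m + \<Sum>{..<card X}}"
  unfolding a_core_def
proof (rule bij_betw_same_card[of beta_set], unfold bij_betw_def, intro conjI)
  let ?P = "{lam. is_partition m lam \<and> is_core t lam}"
  show "inj_on beta_set ?P"
    by (rule inj_onI) (auto simp: is_partition_def intro: beta_set_inj)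
  show "beta_set ` ?P = {X. core_set t X \<and> \<Sum>X = m + \<Sum>{..<card X}}"
  proof (intro equalityI subsetI)
    fix X assume "X \<in> beta_set ` ?P"
    then show "X \<in> {X. core_set t X \<and> \<Sum>X = m + \<Sum>{..<card X}}"
      using is_core_iff_core_set[OF _ _ assms]
      by (auto simp: is_partition_def sum_beta_set card_beta_set)
  next
    fix X assume X: "X \<in> {X. core_set t X \<and> \<Sum>X = m + \<Sum>{..<card X}}"
    then obtain lam where lam: "sorted_wrt (\<ge>) lam" "\<forall>x\<in>set lam. 0 < x" "beta_set lam = X"
      using beta_set_surj[of X] by (auto simp: core_set_def)
    then have "lam \<in> ?P"
      using X is_core_iff_core_set[OF lam(1,2) assms] sum_beta_set[OF lam(1)] card_beta_set[OF lam(1)]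
      by (auto simp: is_partition_def)
    then show "X \<in> beta_set ` ?P" using lam(3) by blast
  qed
qed

lemma even_card_involution_iff:
  assumes "finite S" "\<And>x. x \<in> S \<Longrightarrow> h x \<in> S" "\<And>x. x \<in> S \<Longrightarrow> h (h x) = x"
  shows "even (card S) \<longleftrightarrow> even (card {x \<in> S. h x = x})"
  using assms
proof (induction "card S" arbitrary: S rule: less_induct)
  case less
  show ?case
  proof (cases "\<exists>x\<in>S. h x \<noteq> x")
    case True
    then obtain x where x: "x \<in> S" "h x \<noteq> x" by blast
    let ?S = "S - {x, h x}"
    have hx: "h x \<in> S" "h (h x) = x" using x less.prems by auto
    have card: "card S = card ?S + 2"
    proof -
      have "card {x, h x} = 2" using x by simp
      moreover have "card ?S = card S - card {x, h x}" using x hx less.prems by (intro card_Diff_subset) auto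
      moreover have "card {x, h x} \<le> card S" using x hx less.prems by (intro card_mono) auto
      ultimately show ?thesis by linarith
    qed
    have "even (card ?S) \<longleftrightarrow> even (card {y \<in> ?S. h y = y})"
    proof (rule less.hyps)
      show "h y \<in> ?S" if "y \<in> ?S" for y
      proof -
        have "h (h y) = y" "h y \<in> S" using that less.prems by auto
        then show ?thesis using that hx by auto
      qed
    qed (use card less.prems in auto)
    moreover have "{y \<in> ?S. h y = y} = {y \<in> S. h y = y}" using x hx by auto
    ultimately show ?thesis using card by simp
  next
    case False
    then have "{x \<in> S. h x = x} = S" by auto
    then show ?thesis by simp
  qed
qed

lemma of_nat_bit_eq_iff: "(of_nat a :: bit) = of_nat b \<longleftrightarrow> (even a \<longleftrightarrow> even b)"
  by (simp only: Z2.bit_eq_iff[of "of_nat a" "of_nat b"] even_of_nat)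

text \<open>For a core set, the least missing number of each class modulo \<open>t\<close>. As a
  difference of sets it reduces sums over gaps to sums over \<open>X\<close>.\<close>

definition first_gaps :: "nat \<Rightarrow> nat set \<Rightarrow> nat set" where
  "first_gaps t X = ((+) t ` X \<union> {..<t}) - X"

text \<open>\<open>X\<close> lies in the disjoint union of \<open>t + X\<close> and
  \<open>{..<t}\<close>, with the first gaps as complement. Suitable \<open>h\<close> give the
  cardinality, the sum and the sum of squares.\<close>

lemma sum_first_gaps:
  fixes h :: "nat \<Rightarrow> 'a::ab_group_add"
  assumes "core_set t X"
  shows "(\<Sum>a\<in>first_gaps t X. h a) = (\<Sum>x\<in>X. h (t + x) - h x) + (\<Sum>i<t. h i)"
proof -
  have fin: "finite X" using assms by (simp add: core_set_def)
  have "X \<subseteq> (+) t ` X \<union> {..<t}"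
  proof
    fix x assume "x \<in> X"
    then show "x \<in> (+) t ` X \<union> {..<t}"
      using assms by (cases "t \<le> x") (auto simp: core_set_def intro!: image_eqI[of _ _ "x - t"])
  qed
  then have "(\<Sum>a\<in>(+) t ` X \<union> {..<t}. h a) = (\<Sum>a\<in>first_gaps t X. h a) + (\<Sum>a\<in>X. h a)"
    unfolding first_gaps_def using fin by (intro sum.subset_diff) auto
  moreover have "(\<Sum>a\<in>(+) t ` X \<union> {..<t}. h a) = (\<Sum>a\<in>(+) t ` X. h a) + (\<Sum>i<t. h i)"
    using fin by (intro sum.union_disjoint) auto
  moreover have "(\<Sum>a\<in>(+) t ` X. h a) = (\<Sum>x\<in>X. h (t + x))"
    by (subst sum.reindex) auto
  ultimately have "(\<Sum>a\<in>first_gaps t X. h a) + (\<Sum>a\<in>X. h a) = (\<Sum>x\<in>X. h (t + x)) + (\<Sum>i<t. h i)"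
    by simp
  then show ?thesis by (simp add: sum_subtractf algebra_simps eq_diff_eq)
qed

lemma finite_first_gaps: "core_set t X \<Longrightarrow> finite (first_gaps t X)"
  by (simp add: first_gaps_def core_set_def)

lemma card_first_gaps:
  assumes "core_set t X"
  shows "card (first_gaps t X) = t"
  using sum_first_gaps[OF assms, of "\<lambda>_. 1::int"] by simp

text \<open>Finiteness ends each chain \<open>z, z + t, z + 2 t, ...\<close> of members at a first
  gap, and a core set contains all of the class below that gap.\<close>

lemma core_set_recover:
  assumes "core_set t X" "0 < t"
  shows "X = {z. \<exists>a\<in>first_gaps t X. z < a \<and> t dvd a - z}"
proof (intro equalityI subsetI)
  fix z assume z: "z \<in> X"
  have fin: "finite X" using assms by (simp add: core_set_def)
  have "\<exists>q. z + t * q \<notin> X"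
  proof (rule ccontr)
    assume "\<not> (\<exists>q. z + t * q \<notin> X)"
    then have "range (\<lambda>q. z + t * q) \<subseteq> X" by auto
    moreover have "inj (\<lambda>q. z + t * q)" using assms(2) by (auto simp: inj_def)
    ultimately show False using fin by (meson finite_subset infinite_UNIV_nat range_inj_infinite)
  qed
  then obtain q where q: "z + t * q \<notin> X" "\<And>r. r < q \<Longrightarrow> z + t * r \<in> X"
    using exists_least_iff[of "\<lambda>q. z + t * q \<notin> X"] by blast
  then obtain r where r: "q = Suc r" using z by (cases q) auto
  then have "z + t * r \<in> X" using q by simp
  then have "z + t * q \<in> first_gaps t X"
    unfolding first_gaps_def using q(1) r by (auto intro!: image_eqI[of _ _ "z + t * r"])
  moreover have "z < z + t * q" using r assms(2) by simp
  ultimately show "z \<in> {z. \<exists>a\<in>first_gaps t X. z < a \<and> t dvd a - z}"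
    by (intro CollectI bexI[of _ "z + t * q"]) auto
next
  fix z assume "z \<in> {z. \<exists>a\<in>first_gaps t X. z < a \<and> t dvd a - z}"
  then obtain a q where a: "a \<in> first_gaps t X" "z < a" "a - z = t * q" by blast
  then obtain r where r: "q = Suc r" by (cases q) auto
  have aeq: "a = z + t * r + t" using a r by (simp add: algebra_simps)
  then have "z + t * r \<in> X" using a(1) by (auto simp: first_gaps_def)
  then show "z \<in> X" using core_set_diff_multiple[OF assms(1), of "z + t * r" r] by simp
qed

lemma inj_on_mod_first_gaps:
  assumes "core_set t X" "0 < t"
  shows "inj_on (\<lambda>a. a mod t) (first_gaps t X)"
proof (rule inj_onI)
  have no: False if "a \<in> first_gaps t X" "b \<in> first_gaps t X" "a mod t = b mod t" "a < b" for a b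
  proof -
    have "t dvd b - a" using that mod_eq_dvd_iff_nat[of a b t] by simp
    then have "a \<in> X" using core_set_recover[OF assms] that by blast
    then show False using that(1) by (simp add: first_gaps_def)
  qed
  fix a b assume "a \<in> first_gaps t X" "b \<in> first_gaps t X" "a mod t = b mod t"
  then show "a = b" using no[of a b] no[of b a] by (metis nat_neq_iff)
qed

lemma zero_in_first_gaps: "core_set t X \<Longrightarrow> 0 < t \<Longrightarrow> 0 \<in> first_gaps t X"
  by (simp add: first_gaps_def core_set_def)

text \<open>Each class is filled up to its chosen element; the choice of 0 in its class keeps 0 out
  of \<open>X\<close>.\<close>

lemma core_set_of_residues:
  assumes A: "finite A" "card A = t" "inj_on (\<lambda>a. a mod t) A" "0 \<in> A" and t: "0 < t"
  defines "X \<equiv> {z. \<exists>a\<in>A. z < a \<and> t dvd a - z}"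
  shows "core_set t X" "first_gaps t X = A"
proof -
  have img: "(\<lambda>a. a mod t) ` A = {..<t}"
    using A t by (intro card_subset_eq) (auto simp: card_image)
  have notin: "a \<notin> X" if "a \<in> A" for a
  proof
    assume "a \<in> X"
    then obtain b where b: "b \<in> A" "a < b" "t dvd b - a" by (auto simp: X_def)
    then have "b mod t = a mod t" by (simp add: mod_eq_dvd_iff_nat)
    then have "b = a" using b(1) that by (rule inj_onD[OF A(3)])
    then show False using b by simp
  qed
  have "X \<subseteq> {..<Suc (Max A)}"
    unfolding X_def using A(1) by (auto simp: less_Suc_eq_le intro: order_trans[OF less_imp_le Max_ge])
  then have "finite X" by (rule finite_subset) simp
  moreover have "b - t \<in> X" if b: "b \<in> X" "t \<le> b" for b
  proof -
    obtain a where a: "a \<in> A" "b < a" "t dvd a - b" using b by (auto simp: X_def)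
    have "a - (b - t) = (a - b) + t" using a b by simp
    then have "t dvd a - (b - t)" using a(3) by (simp only: dvd_add dvd_refl)
    then show ?thesis using a b t by (auto simp: X_def intro!: bexI[of _ a])
  qed
  ultimately show "core_set t X" using notin[OF A(4)] by (auto simp: core_set_def)
  show "first_gaps t X = A"
  proof (intro equalityI subsetI)
    fix a assume a: "a \<in> A"
    have "a - t \<in> X" if "t \<le> a"
      using that t a by (auto simp: X_def intro!: bexI[of _ a])
    then show "a \<in> first_gaps t X"
      using notin[OF a] by (cases "t \<le> a") (auto simp: first_gaps_def intro!: image_eqI[of _ _ "a - t"])
  next
    fix z assume z: "z \<in> first_gaps t X"
    then have zX: "z \<notin> X" by (simp add: first_gaps_def)
    have "\<exists>a\<in>A. z \<le> a \<and> t dvd a - z"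
    proof (cases "z < t")
      case True
      then obtain a where a: "a \<in> A" "a mod t = z" using img by (metis image_iff lessThan_iff)
      then have "z \<le> a" "t dvd a - z" using True dvd_minus_mod[of t a] by auto
      then show ?thesis using a by blast
    next
      case False
      then obtain y where y: "y \<in> X" "z = t + y" using z by (auto simp: first_gaps_def)
      then obtain a where a: "a \<in> A" "y < a" "t dvd a - y" by (auto simp: X_def)
      then have "t \<le> a - y" by (intro dvd_imp_le) auto
      then have "z \<le> a" "a - z = (a - y) - t" using y a by auto
      then have "t dvd a - z" using a(3) by (simp only: dvd_diff_nat dvd_refl)
      then show ?thesis using a \<open>z \<le> a\<close> by blast
    qed
    then show "z \<in> A" using zX unfolding X_def by (auto simp: order_le_less)
  qed
qed

section \<open>Parity of the number of 13-cores\<close>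

text \<open>Conjugating a partition replaces the set of first gaps by a translate of its negative; centring
  makes this the involution \<open>A \<mapsto> - A\<close>.\<close>
definition balanced_residues :: "nat \<Rightarrow> int set set" where
  "balanced_residues m = {A. finite A \<and> card A = 13 \<and> inj_on (\<lambda>a. a mod 13) A
     \<and> \<Sum>A = 0 \<and> (\<Sum>a\<in>A. a\<^sup>2) = 26 * (int m + 7)}"

text \<open>The first gaps have sum \<open>13 * card X + 78\<close>, hence mean
  \<open>card X + 6\<close>.\<close>

definition centred_gaps :: "nat set \<Rightarrow> int set" where
  "centred_gaps X = (\<lambda>a. int a - (int (card X) + 6)) ` first_gaps 13 X"

lemma sum_lessThan_13:
  "(\<Sum>i<13. int i) = 78" "(\<Sum>i<13. (int i)\<^sup>2) = 650"
  by (simp_all add: eval_nat_numeral lessThan_Suc)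

lemma two_sum_lessThan: "2 * int (\<Sum>{..<c}) = int c * (int c - 1)"
  by (induction c) (simp_all add: lessThan_Suc algebra_simps)

text \<open>Squares at distance 13 differ by a linear term, so for given \<open>card X\<close> the
  sum of squares is affine in \<open>\<Sum>X\<close>. The constant 182 is the sum of the squares
  from \<open>-6\<close> to \<open>6\<close>.\<close>

lemma sum_centred_gaps:
  assumes "core_set 13 X"
  shows "finite (centred_gaps X)" "card (centred_gaps X) = 13"
    "inj_on (\<lambda>a. a mod 13) (centred_gaps X)" "\<Sum>(centred_gaps X) = 0"
    "(\<Sum>a\<in>centred_gaps X. a\<^sup>2) = 26 * int (\<Sum>X) + 13 * int (card X) - 13 * (int (card X))\<^sup>2 + 182"
proof -
  let ?c = "int (card X)"
  let ?s = "\<lambda>a. int a - (?c + 6)"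
  have inj: "inj_on ?s Y" for Y by (auto simp: inj_on_def)
  show "finite (centred_gaps X)"
    by (simp add: centred_gaps_def finite_first_gaps[OF assms])
  show "card (centred_gaps X) = 13"
    by (simp add: centred_gaps_def card_image[OF inj] card_first_gaps[OF assms])
  have S: "(\<Sum>a\<in>centred_gaps X. h a) = (\<Sum>x\<in>X. h (?s (13 + x)) - h (?s x)) + (\<Sum>i<13. h (?s i))"
    for h :: "int \<Rightarrow> int"
    unfolding centred_gaps_def sum.reindex[OF inj] comp_def by (rule sum_first_gaps[OF assms])
  have c: "(\<Sum>i<13::nat. ?s i) = 78 - 13 * (?c + 6)"
    unfolding sum_subtractf sum_lessThan_13 by simp
  show "\<Sum>(centred_gaps X) = 0"
    unfolding S[of "\<lambda>a. a"] c by simp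
  have "(\<Sum>i<13::nat. (?s i)\<^sup>2) = (\<Sum>i<13::nat. (int i)\<^sup>2 - 2 * (?c + 6) * int i + (?c + 6)\<^sup>2)"
    by (rule sum.cong) (simp_all add: power2_eq_square algebra_simps)
  also have "\<dots> = 650 - 2 * (?c + 6) * 78 + 13 * (?c + 6)\<^sup>2"
    unfolding sum.distrib sum_subtractf sum_distrib_left[symmetric] sum_lessThan_13 by simp
  finally have c2: "(\<Sum>i<13::nat. (?s i)\<^sup>2) = 650 - 2 * (?c + 6) * 78 + 13 * (?c + 6)\<^sup>2" .
  have "(\<Sum>x\<in>X. (?s (13 + x))\<^sup>2 - (?s x)\<^sup>2) = (\<Sum>x\<in>X. 26 * int x + (13 - 26 * ?c))"
    by (rule sum.cong) (simp_all add: power2_eq_square algebra_simps)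
  also have "\<dots> = 26 * int (\<Sum>X) + ?c * (13 - 26 * ?c)"
    by (simp add: sum.distrib sum_distrib_left)
  finally show "(\<Sum>a\<in>centred_gaps X. a\<^sup>2) = 26 * int (\<Sum>X) + 13 * ?c - 13 * ?c\<^sup>2 + 182"
    unfolding S[of "\<lambda>a. a\<^sup>2"] c2 by (simp add: power2_eq_square algebra_simps)
  show "inj_on (\<lambda>a. a mod 13) (centred_gaps X)"
    unfolding centred_gaps_def
  proof (rule inj_on_imageI, rule inj_onI)
    fix a b assume ab: "a \<in> first_gaps 13 X" "b \<in> first_gaps 13 X"
      and "((\<lambda>a. a mod 13) \<circ> ?s) a = ((\<lambda>a. a mod 13) \<circ> ?s) b"
    then have "?s a mod 13 = ?s b mod 13" by simp
    then have "int a mod 13 = int b mod 13"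
      by (simp add: mod_eq_dvd_iff)
    then have "a mod 13 = b mod 13" by (metis nat_int_comparison(1) of_nat_mod of_nat_numeral)
    then show "a = b" using inj_onD[OF inj_on_mod_first_gaps[OF assms]] ab by simp
  qed
qed

lemma centred_gaps_in_iff:
  assumes "core_set 13 X"
  shows "centred_gaps X \<in> balanced_residues m \<longleftrightarrow> \<Sum>X = m + \<Sum>{..<card X}"
proof -
  have "centred_gaps X \<in> balanced_residues m \<longleftrightarrow>
      26 * int (\<Sum>X) + 13 * int (card X) - 13 * (int (card X))\<^sup>2 + 182 = 26 * (int m + 7)"
    using sum_centred_gaps[OF assms] by (simp add: balanced_residues_def)
  also have "\<dots> \<longleftrightarrow> 2 * int (\<Sum>X) = 2 * int m + 2 * int (\<Sum>{..<card X})"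
    unfolding two_sum_lessThan by (simp add: power2_eq_square algebra_simps) linarith
  also have "\<dots> \<longleftrightarrow> \<Sum>X = m + \<Sum>{..<card X}" by linarith
  finally show ?thesis .
qed

text \<open>Since 0 is a first gap, the minimum reveals \<open>card X\<close> and thereby undoes the
  centring.\<close>

lemma Min_centred_gaps:
  assumes "core_set 13 X"
  shows "Min (centred_gaps X) = - (int (card X) + 6)"
  using zero_in_first_gaps[OF assms] finite_first_gaps[OF assms] unfolding centred_gaps_def
  by (intro Min_eqI) force+

lemma bij_betw_centred_gaps:
  "bij_betw centred_gaps {X. core_set 13 X \<and> \<Sum>X = m + \<Sum>{..<card X}} (balanced_residues m)"
  unfolding bij_betw_def
proof (intro conjI equalityI subsetI)
  show "inj_on centred_gaps {X. core_set 13 X \<and> \<Sum>X = m + \<Sum>{..<card X}}"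
  proof (rule inj_onI, clarify)
    fix X Y assume X: "core_set 13 X" and Y: "core_set 13 Y" and eq: "centred_gaps X = centred_gaps Y"
    have "card X = card Y" using Min_centred_gaps[OF X] Min_centred_gaps[OF Y] eq by simp
    moreover have "inj (\<lambda>a. int a - (int (card Y) + 6))" by (simp add: inj_def)
    ultimately have "first_gaps 13 X = first_gaps 13 Y"
      using eq unfolding centred_gaps_def by (simp only: inj_image_eq_iff)
    then show "X = Y" using core_set_recover[OF X] core_set_recover[OF Y] by simp
  qed
next
  fix A assume "A \<in> centred_gaps ` {X. core_set 13 X \<and> \<Sum>X = m + \<Sum>{..<card X}}"
  then show "A \<in> balanced_residues m" using centred_gaps_in_iff by auto
next
  fix A assume A: "A \<in> balanced_residues m"
  then have fin: "finite A" and card: "card A = 13" and inj: "inj_on (\<lambda>a. a mod 13) A" and sum: "\<Sum>A = 0"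
    by (auto simp: balanced_residues_def)
  \<comment> \<open>Moving the minimum to 0 yields a transversal containing 0, as
    \<open>core_set_of_residues\<close> demands.\<close>
  define s where "s = Min A"
  have "A \<noteq> {}" using card by auto
  then have sA: "s \<in> A" and s_le: "a \<in> A \<Longrightarrow> s \<le> a" for a unfolding s_def using fin by auto
  define B where "B = (\<lambda>a. nat (a - s)) ` A"
  have injn: "inj_on (\<lambda>a. nat (a - s)) A"
  proof (rule inj_onI)
    fix x y assume "x \<in> A" "y \<in> A" "nat (x - s) = nat (y - s)"
    then show "x = y" using s_le[of x] s_le[of y] by linarith
  qed
  have AB: "A = (\<lambda>b. int b + s) ` B" unfolding B_def image_image using s_le by (auto simp: image_iff)
  have B: "finite B" "card B = 13" "0 \<in> B"
    unfolding B_def using fin card sA by (auto simp: card_image[OF injn] image_iff)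
  have "inj_on (\<lambda>b. b mod 13) B"
  proof (rule inj_onI)
    fix b b' assume b: "b \<in> B" "b' \<in> B" "b mod 13 = b' mod 13"
    then have "int b mod 13 = int b' mod 13" by (metis of_nat_mod of_nat_numeral)
    then have "(int b + s) mod 13 = (int b' + s) mod 13" by (simp add: mod_eq_dvd_iff)
    moreover have "int b + s \<in> A" "int b' + s \<in> A" using b AB by auto
    ultimately have "int b + s = int b' + s" using inj by (meson inj_onD)
    then show "b = b'" by simp
  qed
  note B = B(1,2) this B(3)
  define X where "X = {z. \<exists>a\<in>B. z < a \<and> 13 dvd a - z}"
  have core: "core_set 13 X" and gaps: "first_gaps 13 X = B"
    unfolding X_def using core_set_of_residues[OF B] by simp_all
  \<comment> \<open>The zero sum of \<open>A\<close> forces the translation to be the centring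
    one.\<close>
  have "0 = (\<Sum>b\<in>B. int b + s)"
    using sum by (subst (asm) AB, subst (asm) sum.reindex) (auto simp: inj_on_def)
  also have "\<dots> = (\<Sum>b\<in>first_gaps 13 X. int b) + 13 * s"
    using B(2) by (simp add: sum.distrib gaps)
  also have "(\<Sum>b\<in>first_gaps 13 X. int b) = 13 * int (card X) + 78"
    unfolding sum_first_gaps[OF core, of int] sum_lessThan_13 by simp
  finally have "s = - (int (card X) + 6)" by simp
  then have AX: "A = centred_gaps X"
    unfolding centred_gaps_def gaps by (subst AB) (intro image_cong refl, linarith)
  then have "\<Sum>X = m + \<Sum>{..<card X}" using A centred_gaps_in_iff[OF core] by simp
  then show "A \<in> centred_gaps ` {X. core_set 13 X \<and> \<Sum>X = m + \<Sum>{..<card X}}"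
    using core AX by blast
qed

lemma a_core_13_eq_card: "a_core 13 m = card (balanced_residues m)"
  using a_core_eq_card_core_sets[of 13 m] bij_betw_same_card[OF bij_betw_centred_gaps[of m]] by simp

lemma finite_balanced_residues: "finite (balanced_residues m)"
proof (rule finite_subset)
  let ?K = "26 * (int m + 7)"
  show "balanced_residues m \<subseteq> Pow {- ?K..?K}"
  proof (clarify)
    fix A a assume A: "A \<in> balanced_residues m" and a: "a \<in> A"
    then have "a\<^sup>2 \<le> (\<Sum>a\<in>A. a\<^sup>2)"
      by (intro member_le_sum) (auto simp: balanced_residues_def)
    then have "a\<^sup>2 \<le> ?K" using A by (simp add: balanced_residues_def)
    moreover have "\<bar>a\<bar> \<le> a\<^sup>2"
    proof (cases "a = 0")
      case False
      then have "\<bar>a\<bar> * 1 \<le> \<bar>a\<bar> * \<bar>a\<bar>" by (intro mult_left_mono) auto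
      then show ?thesis by (simp add: power2_eq_square)
    qed simp
    ultimately show "a \<in> {- ?K..?K}" by auto
  qed
qed simp

lemma uminus_balanced_residues:
  assumes "A \<in> balanced_residues m"
  shows "uminus ` A \<in> balanced_residues m"
proof -
  have inj: "inj_on uminus Y" for Y :: "int set" by simp
  have "inj_on (\<lambda>a. a mod 13) (uminus ` A)"
  proof (rule inj_on_imageI, rule inj_onI)
    fix a b assume ab: "a \<in> A" "b \<in> A" "((\<lambda>a. a mod 13) \<circ> uminus) a = ((\<lambda>a. a mod 13) \<circ> uminus) b"
    then have "a mod 13 = b mod 13" using mod_minus_cong[of "- a" 13 "- b"] by simp
    then show "a = b" using ab assms by (auto simp: balanced_residues_def dest: inj_onD)
  qed
  then show ?thesis using assms
    by (simp add: balanced_residues_def card_image[OF inj] sum.reindex[OF inj] comp_def sum_negf)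
qed

text \<open>A symmetric transversal: the element in the class of \<open>j\<close> is
  \<open>13 * g j + j\<close> with \<open>g\<close> extended to an odd function.\<close>

definition odd_extension :: "(nat \<Rightarrow> int) \<Rightarrow> int \<Rightarrow> int" where
  "odd_extension g j = 13 * (sgn j * g (nat \<bar>j\<bar>)) + j"

lemma sum_symmetric_13:
  fixes h :: "int \<Rightarrow> 'a::comm_monoid_add"
  shows "(\<Sum>j\<in>{-6..6}. h j) = h 0 + (\<Sum>i\<in>{1..6::nat}. h (int i) + h (- int i))"
proof -
  have "{-6..6::int} = {0,1,2,3,4,5,6,-1,-2,-3,-4,-5,-6}" by (auto, presburger)
  moreover have "{1..6::nat} = {1,2,3,4,5,6}" by auto
  ultimately show ?thesis by (simp add: ac_simps)
qed

lemma odd_extension_mod: "odd_extension g j mod 13 = j mod 13"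
  by (simp add: odd_extension_def)

lemma odd_extension_uminus: "odd_extension g (- j) = - odd_extension g j"
  by (simp add: odd_extension_def sgn_minus)

lemma mod_13_inj: "j \<in> {-6..6} \<Longrightarrow> k \<in> {-6..6} \<Longrightarrow> j mod 13 = k mod (13::int) \<Longrightarrow> j = k"
  unfolding mod_eq_dvd_iff by (rule ccontr) (use dvd_imp_le_int[of "j - k" 13] in auto)

lemma inj_on_odd_extension: "inj_on (odd_extension g) {-6..6}"
  by (rule inj_onI) (metis mod_13_inj odd_extension_mod)

text \<open>Oddness makes the sum vanish. With \<open>e = 13 g^2 + 2 i g\<close>, the value of
  \<open>theta_exp\<close>, one has \<open>(13 g + i)^2 = 13 e + i^2\<close>, and
  \<open>2 * 91 = 26 * 7\<close> accounts for the constant.\<close>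

lemma odd_extension_in_iff:
  "odd_extension g ` {-6..6} \<in> balanced_residues m \<longleftrightarrow>
     (\<Sum>i\<in>{1..6}. theta_exp (13 + 2 * i) (13 - 2 * i) (g i)) = m"
proof -
  let ?A = "odd_extension g ` {-6..6}"
  have inj: "inj_on (\<lambda>a. a mod 13) ?A"
    by (rule inj_on_imageI, rule inj_onI) (simp add: odd_extension_mod mod_13_inj)
  have S: "(\<Sum>a\<in>?A. h a) = h 0 + (\<Sum>i\<in>{1..6::nat}. h (13 * g i + int i) + h (- (13 * g i + int i)))" for h :: "int \<Rightarrow> int"
    unfolding sum.reindex[OF inj_on_odd_extension] sum_symmetric_13 comp_def odd_extension_uminus
    by (auto simp: odd_extension_def intro!: sum.cong)
  have "(13 * g i + int i)\<^sup>2 = 13 * int (theta_exp (13 + 2 * i) (13 - 2 * i) (g i)) + (int i)\<^sup>2"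
    if "i \<in> {1..6}" for i
  proof -
    have "2 * int (theta_exp (13 + 2 * i) (13 - 2 * i) (g i)) = 2 * (13 * (g i)\<^sup>2 + 2 * int i * g i)"
      unfolding two_theta_exp using that by (simp add: of_nat_diff power2_eq_square algebra_simps)
    then have e: "int (theta_exp (13 + 2 * i) (13 - 2 * i) (g i)) = 13 * (g i)\<^sup>2 + 2 * int i * g i" by simp
    show ?thesis unfolding e by (simp add: power2_eq_square algebra_simps)
  qed
  then have "(\<Sum>i\<in>{1..6}. (13 * g i + int i)\<^sup>2)
      = (\<Sum>i\<in>{1..6}. 13 * int (theta_exp (13 + 2 * i) (13 - 2 * i) (g i)) + (int i)\<^sup>2)"
    by (intro sum.cong refl)
  moreover have "(\<Sum>a\<in>?A. a\<^sup>2) = 2 * (\<Sum>i\<in>{1..6}. (13 * g i + int i)\<^sup>2)"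
    unfolding S[of "\<lambda>a. a\<^sup>2"] power2_minus sum.distrib by simp
  ultimately have "(\<Sum>a\<in>?A. a\<^sup>2) = 2 * (\<Sum>i\<in>{1..6}. 13 * int (theta_exp (13 + 2 * i) (13 - 2 * i) (g i)) + (int i)\<^sup>2)"
    by (simp only:)
  also have "\<dots> = 26 * int (\<Sum>i\<in>{1..6}. theta_exp (13 + 2 * i) (13 - 2 * i) (g i)) + 2 * (\<Sum>i\<in>{1..6::nat}. (int i)\<^sup>2)"
    by (simp add: sum.distrib sum_distrib_left)
  also have "(\<Sum>i\<in>{1..6::nat}. (int i)\<^sup>2) = 91"
    by (simp add: eval_nat_numeral atLeastAtMostSuc_conv)
  finally have sq: "(\<Sum>a\<in>?A. a\<^sup>2) = 26 * int (\<Sum>i\<in>{1..6}. theta_exp (13 + 2 * i) (13 - 2 * i) (g i)) + 182"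
    by simp
  have affine: "26 * a + 182 = 26 * (b + 7) \<longleftrightarrow> a = b" for a b :: int by auto
  have "\<Sum>?A = 0" unfolding S[of "\<lambda>a. a"] by simp
  then have "?A \<in> balanced_residues m \<longleftrightarrow> (\<Sum>a\<in>?A. a\<^sup>2) = 26 * (int m + 7)"
    using inj by (simp add: balanced_residues_def card_image[OF inj_on_odd_extension])
  also have "\<dots> \<longleftrightarrow> int (\<Sum>i\<in>{1..6}. theta_exp (13 + 2 * i) (13 - 2 * i) (g i)) = int m"
    unfolding sq by (rule affine)
  also have "\<dots> \<longleftrightarrow> (\<Sum>i\<in>{1..6}. theta_exp (13 + 2 * i) (13 - 2 * i) (g i)) = m"
    by (rule of_nat_eq_iff)
  finally show ?thesis .
qed

lemma uminus_odd_extension: "uminus ` odd_extension g ` {-6..6} = odd_extension g ` {-6..6}"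
proof -
  have "uminus ` odd_extension g ` {-6..6} = odd_extension g ` uminus ` {-6..6}"
    by (simp only: image_image odd_extension_uminus)
  also have "uminus ` {-6..6::int} = {-6..6}" by simp
  finally show ?thesis .
qed

text \<open>The element in the class of \<open>i\<close> determines \<open>g i\<close>, and its
  negative lies in the class of \<open>- i\<close>. The element in the class 0 shares its class with
  its negative, hence is 0.\<close>

lemma symmetric_residues_surj:
  assumes "A \<in> balanced_residues m" "uminus ` A = A"
  shows "\<exists>g\<in>PiE {1..6} (\<lambda>_. UNIV). A = odd_extension g ` {-6..6}"
proof -
  have fin: "finite A" and card: "card A = 13" and inj: "inj_on (\<lambda>a. a mod 13) A"
    using assms by (auto simp: balanced_residues_def)
  have img: "(\<lambda>a. a mod 13) ` A = {0..<13}"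
    using card by (intro card_subset_eq) (auto simp: card_image[OF inj])
  have "\<exists>a\<in>A. a mod 13 = int i" if "i < 13" for i
  proof -
    have "int i \<in> (\<lambda>a. a mod 13) ` A" unfolding img using that by simp
    then show ?thesis by force
  qed
  then obtain c where c: "\<And>i. i < 13 \<Longrightarrow> c i \<in> A \<and> c i mod 13 = int i" by metis
  define g where "g = restrict (\<lambda>i. (c i - int i) div 13) {1..6}"
  have pos: "odd_extension g (int i) \<in> A" if "i \<in> {1..6}" for i
  proof -
    have "c i mod 13 = int i" "c i \<in> A" using c[of i] that by auto
    then have "13 * ((c i - int i) div 13) + int i = c i"
      by (metis add_diff_cancel_left' diff_add_cancel minus_mod_eq_mult_div nonzero_mult_div_cancel_left zero_neq_numeral)
    then show ?thesis using that \<open>c i \<in> A\<close> by (simp add: odd_extension_def g_def)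
  qed
  have neg: "- a \<in> A" if "a \<in> A" for a using assms(2) that by blast
  have zero: "0 \<in> A"
  proof -
    have "c 0 \<in> A" "c 0 mod 13 = 0" using c[of 0] by auto
    moreover from this have "(- c 0) mod 13 = 0" by (simp add: mod_0_imp_dvd)
    ultimately have "- c 0 = c 0" using inj_onD[OF inj, of "- c 0" "c 0"] neg by simp
    then show ?thesis using \<open>c 0 \<in> A\<close> by simp
  qed
  have "odd_extension g j \<in> A" if "j \<in> {-6..6}" for j
  proof -
    have "j = 0 \<or> (j = int (nat j) \<and> nat j \<in> {1..6}) \<or> (j = - int (nat (- j)) \<and> nat (- j) \<in> {1..6})"
      using that by auto
    then consider "j = 0" | i where "j = int i" "i \<in> {1..6}" | i where "j = - int i" "i \<in> {1..6}"
      by blast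
    then show ?thesis
    proof cases
      case 1
      then show ?thesis using zero by (simp add: odd_extension_def)
    next
      case (2 i)
      then show ?thesis using pos by blast
    next
      case (3 i)
      then show ?thesis using neg[OF pos] by (simp only: odd_extension_uminus)
    qed
  qed
  then have "odd_extension g ` {-6..6} = A"
    using fin card by (intro card_subset_eq) (auto simp: card_image[OF inj_on_odd_extension])
  moreover have "g \<in> PiE {1..6} (\<lambda>_. UNIV)" by (simp add: g_def)
  ultimately show ?thesis by blast
qed

lemma card_symmetric_residues:
  "card {A \<in> balanced_residues m. uminus ` A = A} =
   card {g \<in> PiE {1..6} (\<lambda>_. UNIV). (\<Sum>i\<in>{1..6}. theta_exp (13 + 2 * i) (13 - 2 * i) (g i)) = m}"
proof (rule bij_betw_same_card[symmetric], unfold bij_betw_def, intro conjI equalityI subsetI)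
  let ?h = "\<lambda>g. odd_extension g ` {-6..6}"
  let ?S = "{g \<in> PiE {1..6} (\<lambda>_. UNIV). (\<Sum>i\<in>{1..6}. theta_exp (13 + 2 * i) (13 - 2 * i) (g i)) = m}"
  show "inj_on ?h ?S"
  proof (rule inj_onI)
    fix g g' assume g: "g \<in> ?S" "g' \<in> ?S" and eq: "?h g = ?h g'"
    show "g = g'"
    proof (rule PiE_ext[of g "{1..6}" "\<lambda>_. UNIV" g'])
      fix i :: nat assume i: "i \<in> {1..6}"
      then have "odd_extension g (int i) \<in> ?h g'" unfolding eq[symmetric] by auto
      then obtain j where j: "j \<in> {-6..6}" "odd_extension g (int i) = odd_extension g' j" by blast
      then have "int i mod 13 = j mod 13" using odd_extension_mod by metis
      then have "j = int i" using i j(1) mod_13_inj[of "int i" j] by auto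
      then show "g i = g' i" using j(2) i by (simp add: odd_extension_def)
    qed (use g in auto)
  qed
  fix A
  show "A \<in> {A \<in> balanced_residues m. uminus ` A = A}" if A: "A \<in> ?h ` ?S"
  proof -
    obtain g where "A = ?h g" "g \<in> ?S" using A by blast
    then show ?thesis using odd_extension_in_iff[of g m] uminus_odd_extension[of g] by blast
  qed
  show "A \<in> ?h ` ?S" if "A \<in> {A \<in> balanced_residues m. uminus ` A = A}"
    using that symmetric_residues_surj[of A m] odd_extension_in_iff[of _ m] by auto
qed

text \<open>Negation is an involution on the balanced sets, and the six theta series count its fixed
  points.\<close>

lemma a_core_13_bit:
  "of_nat (a_core 13 m) = (\<Prod>i\<in>{1..6}. theta (13 + 2 * i) (13 - 2 * i)) $ m"
proof -
  have "even (card (balanced_residues m)) \<longleftrightarrow> even (card {A \<in> balanced_residues m. uminus ` A = A})"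
    by (rule even_card_involution_iff)
      (auto simp: finite_balanced_residues uminus_balanced_residues image_image)
  then show ?thesis
    unfolding a_core_13_eq_card card_symmetric_residues
    by (subst prod_theta_nth) (auto simp: of_nat_bit_eq_iff)
qed

section \<open>2-cores and triangular numbers\<close>

text \<open>Steps of 2 down from an even member would reach 0, and the odd members are closed
  downwards: the beta sets of staircases.\<close>

lemma core_set_2:
  assumes "core_set 2 X"
  shows "X = (\<lambda>i. 2 * i + 1) ` {..<card X}"
proof -
  have fin: "finite X" and zero: "0 \<notin> X" using assms by (auto simp: core_set_def)
  have "\<exists>i. 2 * i + 1 \<notin> X"
  proof (rule ccontr)
    assume "\<not> (\<exists>i. 2 * i + 1 \<notin> X)"
    then have "range (\<lambda>i. 2 * i + 1) \<subseteq> X" by auto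
    moreover have "inj (\<lambda>i::nat. 2 * i + 1)" by (auto simp: inj_def)
    ultimately show False using fin by (meson finite_subset infinite_UNIV_nat range_inj_infinite)
  qed
  then obtain c where c: "2 * c + 1 \<notin> X" "\<And>i. i < c \<Longrightarrow> 2 * i + 1 \<in> X"
    using exists_least_iff[of "\<lambda>i. 2 * i + 1 \<notin> X"] by blast
  have "X = (\<lambda>i. 2 * i + 1) ` {..<c}"
  proof (intro equalityI subsetI)
    fix b assume b: "b \<in> X"
    have "odd b"
    proof
      assume "even b"
      then show False using core_set_diff_multiple[OF assms b, of "b div 2"] zero by simp
    qed
    then obtain i where i: "b = 2 * i + 1" by (elim oddE)
    have "i < c"
    proof (rule ccontr)
      assume "\<not> i < c"
      then have "2 * (i - c) \<le> b" "b - 2 * (i - c) = 2 * c + 1" using i by auto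
      then show False using core_set_diff_multiple[OF assms b, of "i - c"] c(1) by simp
    qed
    then show "b \<in> (\<lambda>i. 2 * i + 1) ` {..<c}" using i by auto
  qed (use c in auto)
  moreover from this have "card X = c" by (simp add: card_image inj_on_def)
  ultimately show ?thesis by simp
qed

lemma core_set_2_odds: "core_set 2 ((\<lambda>i. 2 * i + 1) ` {..<c})"
  unfolding core_set_def
proof (intro conjI ballI impI)
  fix b assume "b \<in> (\<lambda>i. 2 * i + 1) ` {..<c}" "2 \<le> b"
  then obtain i where "b = 2 * i + 1" "i < c" "1 \<le> i" by auto
  then show "b - 2 \<in> (\<lambda>i. 2 * i + 1) ` {..<c}" by (intro image_eqI[of _ _ "i - 1"]) auto
qed auto

text \<open>The beta set \<open>{1, 3, ..., 2 c - 1}\<close> has sum \<open>c^2\<close>, so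
  \<open>m = c (c + 1) / 2\<close> and \<open>2 c + 1\<close> is the root of
  \<open>8 m + 1\<close>.\<close>

lemma a_core_2_eq_card_sqrt: "a_core 2 m = card {y. y\<^sup>2 = 8 * m + 1}"
proof -
  let ?O = "\<lambda>c. (\<lambda>i. 2 * i + 1 :: nat) ` {..<c}"
  have cardO: "card (?O c) = c" for c by (simp add: card_image inj_on_def)
  have sumO: "\<Sum>(?O c) = c\<^sup>2" for c
  proof -
    have "\<Sum>(?O c) = (\<Sum>i<c. 2 * i + 1)" by (subst sum.reindex) (auto simp: inj_on_def)
    also have "\<dots> = c\<^sup>2" by (induction c) (simp_all add: power2_eq_square)
    finally show ?thesis .
  qed
  have size: "c\<^sup>2 = m + \<Sum>{..<c} \<longleftrightarrow> (2 * c + 1)\<^sup>2 = 8 * m + 1" for c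
  proof -
    have "c\<^sup>2 = m + \<Sum>{..<c} \<longleftrightarrow> 2 * (int c)\<^sup>2 = 2 * int m + 2 * int (\<Sum>{..<c})"
      unfolding of_nat_power[symmetric] by linarith
    also have "\<dots> \<longleftrightarrow> int ((2 * c + 1)\<^sup>2) = int (8 * m + 1)"
      unfolding two_sum_lessThan by (simp add: power2_eq_square algebra_simps) linarith
    finally show ?thesis by (simp only: of_nat_eq_iff)
  qed
  have "bij_betw (\<lambda>X. 2 * card X + 1) {X. core_set 2 X \<and> \<Sum>X = m + \<Sum>{..<card X}} {y. y\<^sup>2 = 8 * m + 1}"
    unfolding bij_betw_def
  proof (intro conjI equalityI subsetI)
    show "inj_on (\<lambda>X. 2 * card X + 1) {X. core_set 2 X \<and> \<Sum>X = m + \<Sum>{..<card X}}"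
    proof (rule inj_onI, clarify)
      fix X Y assume X: "core_set 2 X" and Y: "core_set 2 Y" and "2 * card X + 1 = 2 * card Y + 1"
      then have "card X = card Y" by simp
      then show "X = Y" using core_set_2[OF X] core_set_2[OF Y] by simp
    qed
  next
    fix y assume "y \<in> (\<lambda>X. 2 * card X + 1) ` {X. core_set 2 X \<and> \<Sum>X = m + \<Sum>{..<card X}}"
    then obtain X where X: "core_set 2 X" "\<Sum>X = m + \<Sum>{..<card X}" "y = 2 * card X + 1" by blast
    have "\<Sum>X = (card X)\<^sup>2" using core_set_2[OF X(1)] sumO[of "card X"] by simp
    then show "y \<in> {y. y\<^sup>2 = 8 * m + 1}" using X size[of "card X"] by simp
  next
    fix y assume y: "y \<in> {y. y\<^sup>2 = 8 * m + 1}"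
    then have "odd (y\<^sup>2)" by simp
    then obtain c where c: "y = 2 * c + 1" by (auto elim: oddE)
    then have "c\<^sup>2 = m + \<Sum>{..<c}" using y size[of c] by simp
    then have "?O c \<in> {X. core_set 2 X \<and> \<Sum>X = m + \<Sum>{..<card X}}"
      using core_set_2_odds[of c] by (simp only: mem_Collect_eq cardO sumO)
    then show "y \<in> (\<lambda>X. 2 * card X + 1) ` {X. core_set 2 X \<and> \<Sum>X = m + \<Sum>{..<card X}}"
      by (rule rev_image_eqI) (simp only: c cardO)
  qed
  then show ?thesis using a_core_eq_card_core_sets[of 2 m] by (simp add: bij_betw_same_card)
qed

text \<open>Here \<open>8 * theta_exp 3 1 k + 1 = (4 * k + 1)^2\<close>, and for odd
  \<open>y\<close> exactly one of \<open>y\<close> and \<open>- y\<close> is 1 modulo 4.\<close>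

lemma card_theta_exp_3_1: "card {k. theta_exp 3 1 k = m} = card {y. y\<^sup>2 = 8 * m + 1}"
proof (rule bij_betw_same_card)
  have sq: "theta_exp 3 1 k = m \<longleftrightarrow> (nat \<bar>4 * k + 1\<bar>)\<^sup>2 = 8 * m + 1" for k
  proof -
    have "theta_exp 3 1 k = m \<longleftrightarrow> 2 * int (theta_exp 3 1 k) = 2 * int m" by simp
    also have "\<dots> \<longleftrightarrow> (4 * k + 1)\<^sup>2 = 8 * int m + 1"
      unfolding two_theta_exp by (simp add: power2_eq_square algebra_simps) linarith
    also have "\<dots> \<longleftrightarrow> int ((nat \<bar>4 * k + 1\<bar>)\<^sup>2) = int (8 * m + 1)" by (simp add: add.commute)
    finally show ?thesis by (simp only: of_nat_eq_iff)
  qed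
  show "bij_betw (\<lambda>k. nat \<bar>4 * k + 1\<bar>) {k. theta_exp 3 1 k = m} {y. y\<^sup>2 = 8 * m + 1}"
    unfolding bij_betw_def
  proof (intro conjI equalityI subsetI)
    show "inj_on (\<lambda>k. nat \<bar>4 * k + 1\<bar>) {k. theta_exp 3 1 k = m}"
    proof (rule inj_onI)
      fix x y :: int assume "nat \<bar>4 * x + 1\<bar> = nat \<bar>4 * y + 1\<bar>"
      then have "4 * x + 1 = 4 * y + 1 \<or> 4 * x + 1 = - (4 * y + 1)"
        by (simp only: abs_eq_iff[symmetric] eq_nat_nat_iff abs_ge_zero)
      then show "x = y" by presburger
    qed
  next
    fix y assume y: "y \<in> {y. y\<^sup>2 = 8 * m + 1}"
    then have "odd (y\<^sup>2)" by simp
    then have "odd y" by simp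
    then have "\<exists>k. nat \<bar>4 * k + 1\<bar> = y"
    proof (cases "y mod 4 = 1")
      case True
      then have "4 * (int y div 4) + 1 = int y" by presburger
      then show ?thesis by (metis abs_of_nat nat_int)
    next
      case False
      then have "4 * (- int y div 4) + 1 = - int y" using \<open>odd y\<close> by presburger
      then show ?thesis by (metis abs_minus_cancel abs_of_nat nat_int)
    qed
    then show "y \<in> (\<lambda>k. nat \<bar>4 * k + 1\<bar>) ` {k. theta_exp 3 1 k = m}" using y sq by auto
  qed (use sq in auto)
qed

lemma even_a_core_13_iff: "even (a_core 13 (104 * n + 6)) \<longleftrightarrow> even (a_core 2 n)"
proof -
  have "(of_nat (a_core 13 (104 * n + 6)) :: bit) = theta 3 1 $ n"
    unfolding a_core_13_bit by (rule prod_theta_13_nth)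
  also have "\<dots> = of_nat (a_core 2 n)"
    by (simp only: theta_def fps_nth_Abs_fps card_theta_exp_3_1 a_core_2_eq_card_sqrt)
  finally show ?thesis by (simp only: of_nat_bit_eq_iff)
qed

text \<open>For every root \<open>y\<close> for \<open>N\<close>, \<open>p^2\<close> divides
  \<open>y^2\<close> and so \<open>p\<close> divides \<open>y\<close>; multiplication by
  \<open>p\<close> matches the two sets of roots.\<close>

lemma a_core_2_scale:
  assumes "8 * N + 1 = p\<^sup>2 * (8 * M + 1)"
  shows "a_core 2 N = a_core 2 M"
proof -
  have p: "0 < p" using assms by (auto intro!: gr0I)
  have "bij_betw ((*) p) {z. z\<^sup>2 = 8 * M + 1} {y. y\<^sup>2 = 8 * N + 1}"
    unfolding bij_betw_def
  proof (intro conjI equalityI subsetI)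
    show "inj_on ((*) p) {z. z\<^sup>2 = 8 * M + 1}" using p by (auto simp: inj_on_def)
  next
    fix y assume "y \<in> {y. y\<^sup>2 = 8 * N + 1}"
    then have y: "y\<^sup>2 = p\<^sup>2 * (8 * M + 1)" using assms by simp
    then have "p\<^sup>2 dvd y\<^sup>2" by simp
    then have "p dvd y" by simp
    then obtain z where z: "y = p * z" by blast
    then have "p\<^sup>2 * z\<^sup>2 = p\<^sup>2 * (8 * M + 1)" using y by (simp only: power_mult_distrib)
    then have "z\<^sup>2 = 8 * M + 1" using p by (simp only: mult_cancel_left power_eq_0_iff) simp
    then show "y \<in> (*) p ` {z. z\<^sup>2 = 8 * M + 1}" using z by blast
  qed (use assms in \<open>auto simp: power_mult_distrib\<close>)
  then show ?thesis by (simp add: a_core_2_eq_card_sqrt bij_betw_same_card)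
qed

text \<open>The Legendre symbol is 1 or \<open>-1\<close> here, so neither it nor the sign affects
  parity.\<close>

lemma cong_neg_Legendre_mod_2:
  assumes "\<not> [a = 0] (mod q)" "even x \<longleftrightarrow> even y"
  shows "[int x = (-1) * Legendre a q * int y] (mod 2)"
proof -
  have "odd (Legendre a q)" using assms(1) by (simp add: Legendre_def)
  then have "even (int x - (-1) * Legendre a q * int y)"
    using assms(2) by simp
  then show ?thesis by (simp add: cong_iff_dvd_diff)
qed

theorem theorem1p3:
  fixes k n r p :: nat
  assumes "k \<ge> 1" and "prime p" and "p mod 8 = 7" and "p dvd 8 * r + 7"
  shows "([int (a_core 2 (p ^ (k + 1) * n + p * r + (7 * p - 1) div 8))
            = (-1) * Legendre (-2) (int p) * int (a_core 2 (p ^ (k - 1) * n + (8 * r + 7 - p) div (8 * p)))] (mod 2)) \<and>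
         ([int (a_core 13 (104 * p ^ (k + 1) * n + 104 * p * r + 91 * p - 7))
            = (-1) * Legendre (-2) (int p) * int (a_core 13 (104 * p ^ (k - 1) * n + (104 * r + 91) div p - 7))] (mod 2))"
proof -
  obtain s where s: "8 * r + 7 = p * s" using assms(4) by blast
  obtain a where a: "p = 8 * a + 7" using assms(3) by (metis mult_div_mod_eq)
  \<comment> \<open>As \<open>p\<close> is 7 modulo 8, \<open>s\<close> must be 1 modulo 8; hence
    \<open>8 * r + 7 - p = p * (s - 1)\<close> is divisible by \<open>8 * p\<close>.\<close>
  have "(8 * r + 7) mod 8 = (p mod 8) * s mod 8" unfolding s by (simp add: mod_mult_left_eq)
  then have "(7 * s) mod 8 = 7" using assms(3) by simp
  then have "s mod 8 = 1" by presburger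
  then obtain b where b: "s = 8 * b + 1" by (metis mult_div_mod_eq)
  have p0: "0 < p" using a by simp
  define u where "u = p ^ (k - 1)"
  have pk: "p ^ (k + 1) = p\<^sup>2 * u"
  proof -
    have "k + 1 = 2 + (k - 1)" using assms(1) by simp
    then show ?thesis unfolding u_def power_add[symmetric] by simp
  qed
  define N where "N = p ^ (k + 1) * n + p * r + (7 * p - 1) div 8"
  define M where "M = p ^ (k - 1) * n + (8 * r + 7 - p) div (8 * p)"
  have N: "(7 * p - 1) div 8 = 7 * a + 6" "7 * p = 8 * (7 * a + 6) + 1" using a by simp_all
  have "8 * r + 7 - p = (8 * p) * b" unfolding s b by (simp add: algebra_simps)
  then have Mb: "(8 * r + 7 - p) div (8 * p) = b" using p0 by simp
  have M8: "8 * M + 1 = 8 * (u * n) + s" unfolding M_def Mb u_def b by simp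
  have "8 * N + 1 = 8 * (p\<^sup>2 * u * n) + p * (8 * r) + 7 * p"
    unfolding N_def N(1) pk N(2) by simp
  also have "\<dots> = 8 * (p\<^sup>2 * u * n) + p * (8 * r + 7)" by (simp add: algebra_simps)
  also have "\<dots> = p\<^sup>2 * (8 * (u * n) + s)" unfolding s by (simp add: power2_eq_square algebra_simps)
  finally have NM: "8 * N + 1 = p\<^sup>2 * (8 * M + 1)" unfolding M8 .
  then have eq: "a_core 2 N = a_core 2 M" by (rule a_core_2_scale)
  \<comment> \<open>With 13 added, no truncated subtraction occurs; taking away 7 leaves the
    remainder 6 modulo 104.\<close>
  have "104 * N + 13 = 104 * p ^ (k + 1) * n + 104 * p * r + 91 * p"
    unfolding N_def N(1) using a by simp
  then have L13: "104 * p ^ (k + 1) * n + 104 * p * r + 91 * p - 7 = 104 * N + 6" by linarith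
  have "104 * r + 91 = p * (13 * s)" using s by simp
  then have "(104 * r + 91) div p = 13 * s" using p0 by simp
  then have R13: "104 * p ^ (k - 1) * n + (104 * r + 91) div p - 7 = 104 * M + 6"
    unfolding M_def Mb b by simp
  \<comment> \<open>This rules out the value 0 of the Legendre symbol.\<close>
  have "\<not> int p dvd 2"
  proof
    assume "int p dvd 2"
    then have "int p \<le> 2" by (rule zdvd_imp_le) simp
    then show False using a by simp
  qed
  then have leg: "\<not> [-2 = 0] (mod int p)" by (simp add: cong_0_iff)
  show ?thesis
    unfolding L13 R13 N_def[symmetric] M_def[symmetric]
    by (intro conjI cong_neg_Legendre_mod_2[OF leg]) (simp_all add: eq even_a_core_13_iff)
qed

end
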